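(* Let $V$ be a closed isometric operator in a Hilbert space $H$, let $\mathbf{F}(\delta)$, $\delta\in\mathfrak{B}(\mathbb{T})$, be a spectral measure of $V$, and let $\Delta$ be an open arc of $\mathbb{T}$. The following two conditions are equivalent: (i) $\mathbf{F}(\Delta)=0$; (ii) the generalized resolvent $\mathbf{R}_z(V)$ corresponding to the spectral measure $\mathbf{F}(\delta)$ has an analytic continuation to the set $\mathbb{D}\cup\mathbb{D}_e\cup\overline{\Delta}$, where $\overline{\Delta}=\{z\in\mathbb{C}:\ \overline z\in\Delta\}$.
   Context: All Hilbert spaces are complex and separable. $\mathbb{D}=\{|z|<1\}$, $\mathbb{D}_e=\{|z|>1\}$, $\mathbb{T}=\{|z|=1\}$, $\mathbb{T}_e=\mathbb{D}\cup\mathbb{D}_e$; $\mathfrak{B}(\mathbb{T})$ is the family of Borel subsets of $\mathbb{T}$. A closed isometric operator $V$ in $H$ is a linear isometry defined on a closed subspace $D(V)\subseteq H$ with range in $H$. Let $U\supseteq V$ be a unitary operator in a Hilbert space $\widetilde H\supseteq H$, let $F(\delta)$, $\delta\in\mathfrak{B}(\mathbb{T})$, be the orthogonal (projection-valued) spectral measure of $U$, and let $P^{\widetilde H}_H$ be the orthogonal projection of $\widetilde H$ onto $H$. The operator-valued function $\mathbf{R}_\zeta h=P^{\widetilde H}_H(E_{\widetilde H}-\zeta U)^{-1}h$, $h\in H$, $\zeta\in\mathbb{T}_e$, is called the generalized resolvent, and $\mathbf{F}(\delta)=P^{\widetilde H}_HF(\delta)$ (acting on $H$), $\delta\in\mathfrak{B}(\mathbb{T})$,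 is called the spectral measure of $V$, both corresponding to the extension $U$. Generalized resolvents and spectral measures are in one-to-one correspondence by $$(\mathbf{R}_zh,g)_H=\int_{\mathbb{T}}\frac{1}{1-z\zeta}\,d(\mathbf{F}(\cdot)h,g)_H,\quad h,g\in H,\ z\in\mathbb{T}_e.$$ An analytic continuation to $\mathbb{D}\cup\mathbb{D}_e\cup\overline{\Delta}$ means an analytic operator-valued function on this set that coincides with $\mathbf{R}_z(V)$ on $\mathbb{D}\cup\mathbb{D}_e$. *)

theory Defs
  imports "HOL-Analysis.Analysis"
begin

text \<open>The inner product is linear in the \<^emph>\<open>first\<close> argument.\<close>

class complex_inner = real_normed_vector +
  fixes scaleC :: "complex \<Rightarrow> 'a \<Rightarrow> 'a" (infixr "*\<^sub>C" 75)
    and cinner :: "'a \<Rightarrow> 'a \<Rightarrow> complex"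
  assumes scaleC_add_right: "c *\<^sub>C (x + y) = c *\<^sub>C x + c *\<^sub>C y"
    and scaleC_add_left: "(c + d) *\<^sub>C x = c *\<^sub>C x + d *\<^sub>C x"
    and scaleC_scaleC: "c *\<^sub>C (d *\<^sub>C x) = (c * d) *\<^sub>C x"
    and scaleR_scaleC: "scaleR r x = complex_of_real r *\<^sub>C x"
    and cinner_commute: "cinner x y = cnj (cinner y x)"
    and cinner_add_left: "cinner (x + y) z = cinner x z + cinner y z"
    and cinner_scaleC_left: "cinner (c *\<^sub>C x) y = c * cinner x y"
    and cinner_ge_zero: "0 \<le> Re (cinner x x)"
    and cinner_eq_zero_iff: "cinner x x = 0 \<longleftrightarrow> x = 0"
    and norm_eq_sqrt_cinner: "norm x = sqrt (Re (cinner x x))"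

class chilbert_space = complex_inner + complete_space

lemma scaleC_one: "1 *\<^sub>C x = x" for x :: "'a :: complex_inner"
  using scaleR_scaleC[of 1 x] by simp

interpretation complex_vector: vector_space "scaleC :: complex \<Rightarrow> 'a \<Rightarrow> 'a :: complex_inner"
  by unfold_locales (simp_all add: scaleC_add_right scaleC_add_left scaleC_scaleC scaleC_one)

definition closed_csubspace :: "'a :: complex_inner set \<Rightarrow> bool" where
  "closed_csubspace H \<longleftrightarrow> complex_vector.subspace H \<and> closed H"

definition clinear_on :: "'a :: complex_inner set \<Rightarrow> ('a \<Rightarrow> 'a) \<Rightarrow> bool" where
  "clinear_on S A \<longleftrightarrow> (\<forall>x\<in>S. \<forall>y\<in>S. A (x + y) = A x + A y) \<and> (\<forall>c. \<forall>x\<in>S. A (c *\<^sub>C x) = c *\<^sub>C A x)"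

definition bounded_operator_on :: "'a :: complex_inner set \<Rightarrow> ('a \<Rightarrow> 'a) \<Rightarrow> bool" where
  "bounded_operator_on H A \<longleftrightarrow>
     clinear_on H A \<and> A ` H \<subseteq> H \<and> (\<exists>K. \<forall>h\<in>H. norm (A h) \<le> K * norm h)"

definition orth_proj :: "'a :: complex_inner set \<Rightarrow> 'a \<Rightarrow> 'a" where
  "orth_proj H x = (THE y. y \<in> H \<and> (\<forall>h\<in>H. cinner (x - y) h = 0))"

definition is_orth_projection :: "('a :: complex_inner \<Rightarrow> 'a) \<Rightarrow> bool" where
  "is_orth_projection P \<longleftrightarrow> (\<exists>M. closed_csubspace M \<and> P = orth_proj M)"

text \<open>An operator in \<open>H\<close> with domain \<open>D\<close> is a function of which only the values on \<open>D\<close> matter.\<close>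

definition closed_isometric_operator ::
    "'a :: complex_inner set \<Rightarrow> 'a set \<Rightarrow> ('a \<Rightarrow> 'a) \<Rightarrow> bool" where
  "closed_isometric_operator H D V \<longleftrightarrow>
     closed_csubspace D \<and> D \<subseteq> H \<and> clinear_on D V \<and> V ` D \<subseteq> H \<and> (\<forall>x\<in>D. norm (V x) = norm x)"

definition unitary_operator :: "('a :: complex_inner \<Rightarrow> 'a) \<Rightarrow> bool" where
  "unitary_operator U \<longleftrightarrow>
     Vector_Spaces.linear scaleC scaleC U \<and> surj U \<and> (\<forall>x y. cinner (U x) (U y) = cinner x y)"

abbreviation unit_circle :: "complex set" where
  "unit_circle \<equiv> sphere 0 1"

abbreviation circle_borel :: "complex set set" where
  "circle_borel \<equiv> sets (restrict_space borel unit_circle)"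

definition projection_valued_measure ::
    "(complex set \<Rightarrow> 'a :: complex_inner \<Rightarrow> 'a) \<Rightarrow> bool" where
  "projection_valued_measure F \<longleftrightarrow>
     (\<forall>A\<in>circle_borel. is_orth_projection (F A)) \<and>
     F unit_circle = id \<and>
     (\<forall>A\<in>circle_borel. \<forall>B\<in>circle_borel. F (A \<inter> B) = F A \<circ> F B) \<and>
     (\<forall>A :: nat \<Rightarrow> complex set. range A \<subseteq> circle_borel \<longrightarrow> disjoint_family A \<longrightarrow>
        (\<forall>h. (\<lambda>n. F (A n) h) sums F (\<Union>n. A n) h))"

text \<open>The finite positive measure \<open>(F(\<cdot>)h, h)\<close>.\<close>

definition diag_measure :: "(complex set \<Rightarrow> 'a :: complex_inner \<Rightarrow> 'a) \<Rightarrow> 'a \<Rightarrow> complex measure" where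
  "diag_measure F h =
     measure_of unit_circle circle_borel (\<lambda>A. ennreal (Re (cinner (F A h) h)))"

text \<open>The integral of \<open>f\<close> against the complex measure \<open>(F(\<cdot>)h, g)\<close>, which by polarization equals
  \<open>1/4 \<Sum>\<^sub>k \<i>\<^sup>k (F(\<cdot>)(h + \<i>\<^sup>k g), h + \<i>\<^sup>k g)\<close>, summing over \<open>k = 0, 1, 2, 3\<close>.\<close>

definition spectral_integral ::
    "(complex set \<Rightarrow> 'a :: complex_inner \<Rightarrow> 'a) \<Rightarrow> (complex \<Rightarrow> complex) \<Rightarrow> 'a \<Rightarrow> 'a \<Rightarrow> complex" where
  "spectral_integral F f h g =
     (\<Sum>k<4. \<i> ^ k * (LINT \<zeta>|diag_measure F (h + (\<i> ^ k) *\<^sub>C g). f \<zeta>)) / 4"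

definition spectral_measure_of_unitary ::
    "('a :: complex_inner \<Rightarrow> 'a) \<Rightarrow> (complex set \<Rightarrow> 'a \<Rightarrow> 'a) \<Rightarrow> bool" where
  "spectral_measure_of_unitary U F \<longleftrightarrow>
     projection_valued_measure F \<and>
     (\<forall>h g. cinner (U h) g = spectral_integral F (\<lambda>\<zeta>. \<zeta>) h g)"

text \<open>Here \<open>H\<close> is a closed subspace of the ambient Hilbert space in which the unitary extension
  \<open>U\<close>, with orthogonal spectral measure \<open>F\<close>, acts. Both operators below are to be applied to
  elements of \<open>H\<close> only. For \<open>\<bar>\<zeta>\<bar> \<noteq> 1\<close> the map \<open>x - \<zeta> U x\<close> is bijective, so \<open>inv\<close> is its true inverse.\<close>

definition compressed_spectral_measure ::
    "'a :: complex_inner set \<Rightarrow> (complex set \<Rightarrow> 'a \<Rightarrow> 'a) \<Rightarrow> complex set \<Rightarrow> 'a \<Rightarrow> 'a" where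
  "compressed_spectral_measure H F \<delta> h = orth_proj H (F \<delta> h)"

definition generalized_resolvent ::
    "'a :: complex_inner set \<Rightarrow> ('a \<Rightarrow> 'a) \<Rightarrow> complex \<Rightarrow> 'a \<Rightarrow> 'a" where
  "generalized_resolvent H U \<zeta> h = orth_proj H (inv (\<lambda>x. x - \<zeta> *\<^sub>C U x) h)"

text \<open>Complex differentiability in the operator norm of bounded operators on \<open>H\<close> at every point of
  an open set; operator-norm convergence is uniform convergence on the unit ball of \<open>H\<close>.\<close>

definition operator_analytic_on ::
    "'a :: complex_inner set \<Rightarrow> (complex \<Rightarrow> 'a \<Rightarrow> 'a) \<Rightarrow> complex set \<Rightarrow> bool" where
  "operator_analytic_on H T S \<longleftrightarrow> open S \<and>
     (\<forall>z\<in>S. bounded_operator_on H (T z)) \<and>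
     (\<forall>z\<in>S. \<exists>T'. bounded_operator_on H T' \<and>
        uniform_limit {h \<in> H. norm h \<le> 1}
          (\<lambda>w h. inverse (w - z) *\<^sub>C (T w h - T z h)) T' (at z))"

definition has_analytic_continuation ::
    "'a :: complex_inner set \<Rightarrow> (complex \<Rightarrow> 'a \<Rightarrow> 'a) \<Rightarrow> complex set \<Rightarrow> complex set \<Rightarrow> bool" where
  "has_analytic_continuation H R S S' \<longleftrightarrow>
     S \<subseteq> S' \<and> (\<exists>T. operator_analytic_on H T S' \<and> (\<forall>z\<in>S. \<forall>h\<in>H. T z h = R z h))"

text \<open>Nonempty open arcs of the unit circle; an arc of angular length greater than \<open>2\<pi>\<close> is the
  whole circle, which is thus admitted.\<close>

definition open_arc :: "complex set \<Rightarrow> bool" where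
  "open_arc \<Delta> \<longleftrightarrow> (\<exists>a b. a < b \<and> \<Delta> = cis ` {a<..<b})"

end

theory Submission
  imports Defs
begin

text \<open>Write \<open>\<mu>\<^sub>h = (F(\<cdot>) h, h)\<close>. The argument rests on the formula
  \<open>\<langle>U h, h\<rangle> = \<integral> \<zeta> d\<mu>\<^sub>h\<close> instead of a functional calculus. Since \<open>\<bar>1 - z \<zeta>\<bar>\<^sup>2\<close> is affine in \<open>Re (z \<zeta>)\<close> on the unit
  circle, this formula already gives \<open>\<parallel>x - z U x\<parallel>\<^sup>2 = \<integral> \<bar>1 - z \<zeta>\<bar>\<^sup>2 d\<mu>\<^sub>x\<close> (\<open>norm_resolvent_sq\<close>). Hence
  on the range of \<open>F B\<close> the operator \<open>1 - z U\<close> is bounded below if \<open>1 - z \<zeta>\<close> keeps away from \<open>0\<close> for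
  \<open>\<zeta> \<in> B\<close>, and it is small if \<open>1 - z \<zeta>\<close> is small for \<open>\<zeta> \<in> B\<close>. Moreover \<open>U\<close> commutes with every \<open>F B\<close>
  (\<open>F_commutes_U\<close>), so that these ranges reduce \<open>U\<close>.

  For \<open>h \<in> H\<close> the compression \<open>P\<^sub>H F(\<Delta>) h\<close> vanishes exactly if \<open>F(\<Delta>) h\<close> does, because
  \<open>\<langle>P\<^sub>H F(\<Delta>) h, h\<rangle> = \<parallel>F(\<Delta>) h\<parallel>\<^sup>2\<close>.

  If \<open>F(\<Delta>)\<close> annihilates \<open>H\<close>, then \<open>H\<close> lies in the range \<open>M\<close> of \<open>F\<close> of the complementary closed arc. On
  \<open>M\<close> the operator \<open>1 - z U\<close> stays bounded below and onto when \<open>z\<close> crosses the conjugate arc, so its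
  inverse on \<open>M\<close>, compressed to \<open>H\<close>, is the continuation; the resolvent identity makes it analytic.

  Conversely, suppose that \<open>z \<mapsto> \<langle>R\<^sub>z h, h\<rangle>\<close> is continuous across the conjugate arc. For \<open>\<omega> \<in> \<Delta>\<close> and
  \<open>z = (1 - \<epsilon>) / \<omega>\<close> the jump between \<open>z\<close> and its mirror image in the circle is
  \<open>(1 - \<bar>z\<bar>\<^sup>2) \<parallel>(1 - z U)\<^sup>-\<^sup>1 h\<parallel>\<^sup>2\<close> (\<open>resolvent_jump\<close>, the Poisson integral of \<open>\<mu>\<^sub>h\<close>). If \<open>I\<close> is the part of
  the circle within \<open>\<epsilon>\<close> of \<open>\<omega>\<close>, this is at least \<open>\<mu>\<^sub>h(I) / (4 \<epsilon>)\<close> (\<open>F_cball_le_resolvent_jump\<close>).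
  As the jump tends to zero, \<open>\<mu>\<^sub>h\<close> has zero density at every point of \<open>\<Delta>\<close>, and a bisection argument
  (\<open>null_arc_if_zero_density\<close>) yields \<open>\<mu>\<^sub>h(\<Delta>) = 0\<close>.\<close>

section \<open>Inner products and orthogonal projections\<close>

lemma cinner_add_right: "cinner x (y + z) = cinner x y + cinner x z"
  by (metis cinner_add_left cinner_commute complex_cnj_add)

lemma cinner_scaleC_right: "cinner x (c *\<^sub>C y) = cnj c * cinner x y"
  by (metis cinner_commute cinner_scaleC_left complex_cnj_mult)

lemma cinner_minus_left: "cinner (- x) y = - cinner x y"
  using cinner_scaleC_left[of "-1" x y] by (simp add: complex_vector.scale_minus_left scaleC_one)

lemma cinner_minus_right: "cinner x (- y) = - cinner x y"
  using cinner_scaleC_right[of x "-1" y] by (simp add: complex_vector.scale_minus_left scaleC_one)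

lemma cinner_diff_left: "cinner (x - y) z = cinner x z - cinner y z"
  using cinner_add_left[of x "- y" z] by (simp add: cinner_minus_left)

lemma cinner_diff_right: "cinner x (y - z) = cinner x y - cinner x z"
  using cinner_add_right[of x y "- z"] by (simp add: cinner_minus_right)

lemma cinner_zero_left [simp]: "cinner 0 x = 0"
  using cinner_diff_left[of 0 0 x] by simp

lemma cinner_zero_right [simp]: "cinner x 0 = 0"
  using cinner_diff_right[of x 0 0] by simp

lemma Re_cinner_commute: "Re (cinner x y) = Re (cinner y x)"
  by (subst cinner_commute) simp

lemma Re_cinner_self: "Re (cinner x x) = (norm x)\<^sup>2"
  by (simp add: norm_eq_sqrt_cinner cinner_ge_zero)

lemma cinner_self: "cinner x x = complex_of_real ((norm x)\<^sup>2)"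
proof (rule complex_eqI)
  have "Im (cinner x x) = - Im (cinner x x)"
    by (subst (1) cinner_commute) simp
  then show "Im (cinner x x) = Im (complex_of_real ((norm x)\<^sup>2))"
    by simp
qed (simp add: Re_cinner_self)

lemma norm_scaleC: "norm (c *\<^sub>C x) = cmod c * norm x"
proof -
  have "(norm (c *\<^sub>C x))\<^sup>2 = Re ((c * cnj c) * cinner x x)"
    by (simp add: Re_cinner_self[symmetric] cinner_scaleC_left cinner_scaleC_right mult_ac)
  also have "\<dots> = (cmod c * norm x)\<^sup>2"
    by (simp only: complex_norm_square[symmetric] cinner_self of_real_mult[symmetric]
        Re_complex_of_real power_mult_distrib)
  finally show ?thesis
    by (simp add: power2_eq_iff_nonneg)
qed

lemma norm_add_sq: "(norm (x + y))\<^sup>2 = (norm x)\<^sup>2 + (norm y)\<^sup>2 + 2 * Re (cinner x y)"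
  using Re_cinner_commute[of x y]
  by (simp add: Re_cinner_self[symmetric] cinner_add_left cinner_add_right)

lemma norm_diff_sq: "(norm (x - y))\<^sup>2 = (norm x)\<^sup>2 + (norm y)\<^sup>2 - 2 * Re (cinner x y)"
  using norm_add_sq[of x "- y"] by (simp add: cinner_minus_right)

text \<open>Polarization expresses the inner product by norms, which are continuous.\<close>

lemma tendsto_Re_cinner:
  assumes "(f \<longlongrightarrow> l) G"
  shows "((\<lambda>t. Re (cinner (f t) g)) \<longlongrightarrow> Re (cinner l g)) G"
proof -
  have eq: "Re (cinner x g) = ((norm (x + g))\<^sup>2 - (norm (x - g))\<^sup>2) / 4" for x
    by (simp add: norm_add_sq norm_diff_sq)
  show ?thesis
    unfolding eq by (intro tendsto_intros assms) simp
qed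

text \<open>A minimizing sequence for the distance to the subspace is Cauchy by the parallelogram law; in
  terms of sets, the points of the subspace that are almost closest to \<open>x\<close> form a nested family of
  closed sets with diameters tending to zero.\<close>

lemma orthogonal_projection_exists:
  fixes M :: "'a :: chilbert_space set"
  assumes M: "closed_csubspace M"
  shows "\<exists>y\<in>M. \<forall>h\<in>M. cinner (x - y) h = 0"
proof -
  have sub: "complex_vector.subspace M" and cl: "closed M"
    using M by (auto simp: closed_csubspace_def)
  have ne: "M \<noteq> {}"
    using complex_vector.subspace_0[OF sub] by auto
  define d where "d = (INF m\<in>M. (norm (x - m))\<^sup>2)"
  have bdd: "bdd_below ((\<lambda>m. (norm (x - m))\<^sup>2) ` M)"
    by (intro bdd_belowI[of _ 0]) auto
  have d_le: "d \<le> (norm (x - m))\<^sup>2" if "m \<in> M" for m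
    unfolding d_def using that by (intro cINF_lower bdd)
  define S where "S n = {m \<in> M. (norm (x - m))\<^sup>2 \<le> d + inverse (real (Suc n))}" for n
  have closedS: "closed (S n)" for n
  proof -
    have "S n = M \<inter> {m. (norm (x - m))\<^sup>2 \<le> d + inverse (real (Suc n))}"
      by (auto simp: S_def)
    then show ?thesis
      using cl by (auto intro!: closed_Int closed_Collect_le continuous_intros)
  qed
  have neS: "S n \<noteq> {}" for n
  proof -
    have "d < d + inverse (real (Suc n))"
      by (simp del: of_nat_Suc)
    then obtain m where "m \<in> M" "(norm (x - m))\<^sup>2 < d + inverse (real (Suc n))"
      unfolding d_def using cINF_less_iff[OF ne bdd] by blast
    then show ?thesis
      by (force simp: S_def)
  qed
  have decS: "S n \<subseteq> S m" if "m \<le> n" for m n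
  proof -
    have "inverse (real (Suc n)) \<le> inverse (real (Suc m))"
      using that by (intro le_imp_inverse_le) auto
    then have "r \<le> d + inverse (real (Suc n)) \<Longrightarrow> r \<le> d + inverse (real (Suc m))" for r
      by linarith
    then show ?thesis
      unfolding S_def by blast
  qed
  have diam: "(norm (a - b))\<^sup>2 \<le> 4 * inverse (real (Suc n))" if "a \<in> S n" "b \<in> S n" for a b n
  proof -
    \<comment> \<open>The midpoint also lies in \<open>M\<close>, so its squared distance from \<open>x\<close> is at least \<open>d\<close>.\<close>
    define mid where "mid = (1/2 :: complex) *\<^sub>C (a + b)"
    have "a \<in> M" "b \<in> M"
      using that unfolding S_def by blast+
    then have "mid \<in> M"
      unfolding mid_def by (rule complex_vector.subspace_scale[OF sub complex_vector.subspace_add[OF sub]])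
    moreover have "(x - a) + (x - b) = (2 :: complex) *\<^sub>C (x - mid)"
    proof -
      have "(2 :: complex) *\<^sub>C mid = a + b"
        by (simp add: mid_def scaleC_scaleC scaleC_one)
      moreover have "(2 :: complex) *\<^sub>C x = x + x"
        using scaleC_add_left[of 1 1 x] by (simp add: scaleC_one)
      ultimately show ?thesis
        by (simp add: complex_vector.scale_right_diff_distrib)
    qed
    ultimately have "4 * d \<le> (norm ((x - a) + (x - b)))\<^sup>2"
      using d_le[of mid] by (simp add: norm_scaleC power_mult_distrib)
    moreover have "(norm (a - b))\<^sup>2 = (norm ((x - a) - (x - b)))\<^sup>2"
      by (simp add: norm_minus_commute)
    ultimately show ?thesis
      using that unfolding S_def mem_Collect_eq norm_add_sq norm_diff_sq[of "x - a" "x - b"]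
      by linarith
  qed
  have small: "\<exists>n. \<forall>a\<in>S n. \<forall>b\<in>S n. dist a b < e" if "e > 0" for e
  proof -
    have "0 < e\<^sup>2 / 4"
      using that by simp
    then obtain n where n: "inverse (real (Suc n)) < e\<^sup>2 / 4"
      using reals_Archimedean by blast
    have "dist a b < e" if "a \<in> S n" "b \<in> S n" for a b
    proof -
      have "(norm (a - b))\<^sup>2 < e\<^sup>2"
        using diam[OF that] n by linarith
      then show ?thesis
        unfolding dist_norm by (rule power_less_imp_less_base) (use \<open>e > 0\<close> in simp)
    qed
    then show ?thesis
      by blast
  qed
  obtain y where y: "\<And>n. y \<in> S n"
    using decreasing_closed_nest[OF closedS neS decS small] by blast
  have yM: "y \<in> M"
    using y[of 0] unfolding S_def by blast
  have y_min: "(norm (x - y))\<^sup>2 \<le> d"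
  proof (rule field_le_epsilon)
    fix e :: real assume "e > 0"
    then obtain n where "inverse (real (Suc n)) < e"
      using reals_Archimedean by blast
    moreover have "(norm (x - y))\<^sup>2 \<le> d + inverse (real (Suc n))"
      using y[of n] unfolding S_def by blast
    ultimately show "(norm (x - y))\<^sup>2 \<le> d + e"
      by linarith
  qed
  have "cinner (x - y) h = 0" if h: "h \<in> M" for h
  proof (rule ccontr)
    \<comment> \<open>Moving \<open>y\<close> by a small multiple of \<open>\<langle>x - y, h\<rangle> h\<close> would bring it closer to \<open>x\<close>.\<close>
    define c where "c = cinner (x - y) h"
    define t where "t = 1 / (1 + (norm h)\<^sup>2)"
    assume "cinner (x - y) h \<noteq> 0"
    then have cpos: "(cmod c)\<^sup>2 > 0"
      by (simp add: c_def)
    have t: "t > 0" "t * (norm h)\<^sup>2 \<le> 1"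
      unfolding t_def by (simp_all add: add_pos_nonneg divide_le_eq)
    have "y + (of_real t * c) *\<^sub>C h \<in> M"
      using yM h sub by (intro complex_vector.subspace_add complex_vector.subspace_scale)
    then have "d \<le> (norm ((x - y) - (of_real t * c) *\<^sub>C h))\<^sup>2"
      using d_le by (metis diff_diff_eq)
    also have "\<dots> = (norm (x - y))\<^sup>2 + (t * cmod c * norm h)\<^sup>2
        - 2 * Re (of_real t * (c * cnj c))"
      using t(1) by (simp add: norm_diff_sq norm_scaleC norm_mult cinner_scaleC_right c_def mult_ac)
    also have "(t * cmod c * norm h)\<^sup>2 = t * (t * (norm h)\<^sup>2) * (cmod c)\<^sup>2"
      by (simp add: power2_eq_square)
    also have "2 * Re (of_real t * (c * cnj c)) = 2 * t * (cmod c)\<^sup>2"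
      by (simp add: complex_norm_square[symmetric] del: of_real_power)
    finally have "2 * t * (cmod c)\<^sup>2 \<le> t * (t * (norm h)\<^sup>2) * (cmod c)\<^sup>2"
      using y_min by linarith
    also have "\<dots> \<le> t * 1 * (cmod c)\<^sup>2"
      using t by (intro mult_right_mono mult_left_mono) auto
    finally show False
      using t(1) cpos by simp
  qed
  then show ?thesis
    using yM by blast
qed

lemma orth_proj_eqI:
  assumes M: "closed_csubspace M" and y: "y \<in> M" "\<And>h. h \<in> M \<Longrightarrow> cinner (x - y) h = 0"
  shows "orth_proj M x = y"
  unfolding orth_proj_def
proof (rule the_equality)
  fix z assume z: "z \<in> M \<and> (\<forall>h\<in>M. cinner (x - z) h = 0)"
  have "z - y \<in> M"
    using M z y complex_vector.subspace_diff unfolding closed_csubspace_def by blast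
  then have "cinner (x - y) (z - y) - cinner (x - z) (z - y) = 0"
    using z y by simp
  then have "cinner (z - y) (z - y) = 0"
    by (simp add: cinner_diff_left)
  then show "z = y"
    by (simp add: cinner_eq_zero_iff)
qed (use y in auto)

context
  fixes M :: "'a :: chilbert_space set"
  assumes M: "closed_csubspace M"
begin

lemma orth_proj_in: "orth_proj M x \<in> M"
  and orth_proj_orthogonal: "h \<in> M \<Longrightarrow> cinner (x - orth_proj M x) h = 0"
proof -
  obtain y where "y \<in> M" "\<forall>h\<in>M. cinner (x - y) h = 0"
    using orthogonal_projection_exists[OF M] by blast
  moreover from this have "orth_proj M x = y"
    using orth_proj_eqI[OF M] by blast
  ultimately show "orth_proj M x \<in> M" "h \<in> M \<Longrightarrow> cinner (x - orth_proj M x) h = 0"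
    by auto
qed

lemma orth_proj_ident_iff: "orth_proj M x = x \<longleftrightarrow> x \<in> M"
  using orth_proj_in[of x] orth_proj_eqI[OF M, of x x] by auto

lemma cinner_orth_proj: "h \<in> M \<Longrightarrow> cinner (orth_proj M x) h = cinner x h"
  using orth_proj_orthogonal[of h x] by (simp add: cinner_diff_left)

lemma orth_proj_add: "orth_proj M (x + y) = orth_proj M x + orth_proj M y"
  using M unfolding closed_csubspace_def
  by (intro orth_proj_eqI[OF M] complex_vector.subspace_add orth_proj_in)
    (simp_all add: cinner_add_left cinner_diff_left cinner_orth_proj)

lemma orth_proj_scaleC: "orth_proj M (c *\<^sub>C x) = c *\<^sub>C orth_proj M x"
  using M unfolding closed_csubspace_def
  by (intro orth_proj_eqI[OF M] complex_vector.subspace_scale orth_proj_in)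
    (simp_all add: cinner_scaleC_left cinner_diff_left cinner_orth_proj)

lemma orth_proj_self_adjoint: "cinner (orth_proj M x) y = cinner x (orth_proj M y)"
proof -
  have "cinner (orth_proj M x) y = cnj (cinner y (orth_proj M x))"
    by (rule cinner_commute)
  also have "cinner y (orth_proj M x) = cinner (orth_proj M y) (orth_proj M x)"
    by (simp add: cinner_orth_proj orth_proj_in)
  also have "cnj \<dots> = cinner (orth_proj M x) (orth_proj M y)"
    by (rule cinner_commute[symmetric])
  also have "\<dots> = cinner x (orth_proj M y)"
    by (simp add: cinner_orth_proj orth_proj_in)
  finally show ?thesis .
qed

lemma norm_orth_proj_le: "norm (orth_proj M x) \<le> norm x"
proof -
  have "(norm x)\<^sup>2 = (norm (x - orth_proj M x))\<^sup>2 + (norm (orth_proj M x))\<^sup>2"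
    using norm_add_sq[of "x - orth_proj M x" "orth_proj M x"] orth_proj_orthogonal[OF orth_proj_in]
    by simp
  then show ?thesis
    using power2_le_imp_le[of "norm (orth_proj M x)" "norm x"] by simp
qed

end

section \<open>The measures \<open>(F(\<cdot>) h, h)\<close> and the quadratic form of the unitary operator\<close>

lemma circle_borel_iff: "A \<in> circle_borel \<longleftrightarrow> A \<subseteq> unit_circle \<and> A \<in> sets borel"
  using sets_restrict_space_iff[of unit_circle "borel :: complex measure" A] by auto

lemma sigma_algebra_circle: "sigma_algebra unit_circle circle_borel"
  using sets.sigma_algebra_axioms[of "restrict_space borel unit_circle"]
  by (simp add: space_restrict_space)

lemma integrable_circle:
  fixes f :: "complex \<Rightarrow> 'b :: {banach, second_countable_topology}"
  assumes "finite_measure N" and sets: "sets N = circle_borel"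
    and f: "continuous_on unit_circle f"
  shows "integrable N f"
proof -
  interpret finite_measure N
    by fact
  have "bounded (f ` unit_circle)"
    by (intro compact_imp_bounded compact_continuous_image f) simp
  then obtain K where K: "\<And>\<zeta>. \<zeta> \<in> unit_circle \<Longrightarrow> norm (f \<zeta>) \<le> K"
    unfolding bounded_iff by blast
  have "space N = unit_circle"
    using sets_eq_imp_space_eq[OF sets] by (simp add: space_restrict_space)
  then have "AE \<zeta> in N. norm (f \<zeta>) \<le> K"
    using K by (intro AE_I2) simp
  moreover have "f \<in> borel_measurable N"
    using borel_measurable_continuous_on_restrict[OF f] measurable_cong_sets[OF sets refl]
    by blast
  ultimately show ?thesis
    by (intro integrable_const_bound)
qed

locale spectral_unitary =
  fixes U :: "'a :: chilbert_space \<Rightarrow> 'a" and F :: "complex set \<Rightarrow> 'a \<Rightarrow> 'a"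
  assumes unitary: "unitary_operator U" and spectral: "spectral_measure_of_unitary U F"
begin

lemma U_add: "U (x + y) = U x + U y"
  using unitary unfolding unitary_operator_def
  by (metis Vector_Spaces.linear_iff)

lemma U_scaleC: "U (c *\<^sub>C x) = c *\<^sub>C U x"
  using unitary unfolding unitary_operator_def
  by (metis Vector_Spaces.linear_iff)

lemma U_diff: "U (x - y) = U x - U y"
  using U_add[of "x - y" y] by simp

lemma cinner_U: "cinner (U x) (U y) = cinner x y"
  using unitary by (simp add: unitary_operator_def)

lemma norm_U [simp]: "norm (U x) = norm x"
  by (simp add: norm_eq_sqrt_cinner cinner_U)

lemma U_eq_iff: "U x = U y \<longleftrightarrow> x = y"
  using norm_U[of "x - y"] by (auto simp: U_diff)

lemma U_surj: "\<exists>x. U x = y"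
  using unitary unfolding unitary_operator_def by (metis surjD)

lemma pvm: "projection_valued_measure F"
  using spectral by (simp add: spectral_measure_of_unitary_def)

lemma F_orth_proj:
  assumes "A \<in> circle_borel"
  obtains M where "closed_csubspace M" "F A = orth_proj M"
  using pvm assms unfolding projection_valued_measure_def is_orth_projection_def by blast

lemma F_Int: "A \<in> circle_borel \<Longrightarrow> B \<in> circle_borel \<Longrightarrow> F A (F B x) = F (A \<inter> B) x"
  using pvm by (simp add: projection_valued_measure_def)

lemma F_sums:
  "range A \<subseteq> circle_borel \<Longrightarrow> disjoint_family A \<Longrightarrow> (\<lambda>n. F (A n) h) sums F (\<Union>n. A n) h"
  using pvm unfolding projection_valued_measure_def by blast

lemma F_circle: "F unit_circle x = x"
  using pvm by (simp add: projection_valued_measure_def)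

lemma F_idem: "A \<in> circle_borel \<Longrightarrow> F A (F A x) = F A x"
  by (simp add: F_Int)

lemma F_add: "A \<in> circle_borel \<Longrightarrow> F A (x + y) = F A x + F A y"
  by (metis F_orth_proj orth_proj_add)

lemma F_scaleC: "A \<in> circle_borel \<Longrightarrow> F A (c *\<^sub>C x) = c *\<^sub>C F A x"
  by (metis F_orth_proj orth_proj_scaleC)

lemma F_diff: "A \<in> circle_borel \<Longrightarrow> F A (x - y) = F A x - F A y"
  using F_add[of A "x - y" y] by simp

lemma F_self_adjoint: "A \<in> circle_borel \<Longrightarrow> cinner (F A x) y = cinner x (F A y)"
  by (metis F_orth_proj orth_proj_self_adjoint)

lemma norm_F_le: "A \<in> circle_borel \<Longrightarrow> norm (F A x) \<le> norm x"
  by (metis F_orth_proj norm_orth_proj_le)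

lemma Re_cinner_F: "A \<in> circle_borel \<Longrightarrow> Re (cinner (F A x) x) = (norm (F A x))\<^sup>2"
  by (metis F_idem F_self_adjoint Re_cinner_self)

lemma F_empty: "F {} x = 0"
proof -
  have "(\<lambda>n. F {} x) sums F {} x"
    using F_sums[of "\<lambda>_. {}" x] by (auto simp: disjoint_family_on_def)
  then have "(\<lambda>n. F {} x) \<longlonglongrightarrow> 0"
    by (intro summable_LIMSEQ_zero) (rule sums_summable)
  then show ?thesis
    by (simp add: LIMSEQ_const_iff)
qed

lemma F_Compl:
  assumes A: "A \<in> circle_borel"
  shows "F (unit_circle - A) x = x - F A x"
proof -
  let ?A = "binaryset A (unit_circle - A)"
  have B: "unit_circle - A \<in> circle_borel"
    using A by (auto simp: circle_borel_iff)
  have "(\<lambda>n. F (?A n) x) sums F (\<Union>n. ?A n) x"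
    using A B by (intro F_sums) (auto simp: range_binaryset_eq disjoint_family_on_def binaryset_def)
  moreover have "(\<Union>n. ?A n) = unit_circle"
    using A by (auto simp: UN_binaryset_eq circle_borel_iff)
  moreover have "(\<lambda>n. F (?A n) x) sums (F A x + F (unit_circle - A) x)"
    by (rule binaryset_sums) (rule F_empty)
  ultimately show ?thesis
    by (metis F_circle sums_unique2 add_diff_cancel_left')
qed

lemma F_fixed_Compl: "A \<in> circle_borel \<Longrightarrow> F (unit_circle - A) x = x \<longleftrightarrow> F A x = 0"
  by (simp add: F_Compl)

lemma space_diag_measure [simp]: "space (diag_measure F h) = unit_circle"
  unfolding diag_measure_def using sigma_algebra.space_measure_of_eq[OF sigma_algebra_circle] by simp

lemma sets_diag_measure [simp]: "sets (diag_measure F h) = circle_borel"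
  unfolding diag_measure_def using sigma_algebra.sets_measure_of_eq[OF sigma_algebra_circle] by simp

lemma emeasure_diag_measure:
  assumes A: "A \<in> circle_borel"
  shows "emeasure (diag_measure F h) A = ennreal ((norm (F A h))\<^sup>2)"
proof -
  have "emeasure (diag_measure F h) A = ennreal (Re (cinner (F A h) h))"
    unfolding diag_measure_def
  proof (rule emeasure_measure_of_sigma[OF sigma_algebra_circle _ _ A])
    show "positive circle_borel (\<lambda>A. ennreal (Re (cinner (F A h) h)))"
      by (simp add: positive_def F_empty)
    show "countably_additive circle_borel (\<lambda>A. ennreal (Re (cinner (F A h) h)))"
    proof (rule countably_additiveI)
      fix A :: "nat \<Rightarrow> complex set"
      assume A: "range A \<subseteq> circle_borel" "disjoint_family A"
      have An: "A n \<in> circle_borel" for n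
        using A(1) by blast
      have "(\<lambda>n. Re (cinner (F (A n) h) h)) sums Re (cinner (F (\<Union>n. A n) h) h)"
      proof -
        have "Re (cinner (\<Sum>i<n. F (A i) h) h) = (\<Sum>i<n. Re (cinner (F (A i) h) h))" for n
          by (induction n) (simp_all add: cinner_add_left)
        then show ?thesis
          using tendsto_Re_cinner[OF F_sums[OF A, of h, unfolded sums_def], of h]
          by (simp add: sums_def)
      qed
      then show "(\<Sum>n. ennreal (Re (cinner (F (A n) h) h)))
          = ennreal (Re (cinner (F (\<Union>n. A n) h) h))"
        by (intro suminf_ennreal_eq) (simp_all add: Re_cinner_F[OF An])
    qed
  qed
  then show ?thesis
    by (simp only: Re_cinner_F[OF A])
qed

lemma finite_diag_measure: "finite_measure (diag_measure F h)"
proof (rule finite_measureI)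
  have "unit_circle \<in> circle_borel"
    by (simp add: circle_borel_iff)
  then show "emeasure (diag_measure F h) (space (diag_measure F h)) \<noteq> \<infinity>"
    by (simp add: emeasure_diag_measure)
qed

lemma measure_diag_measure:
  "A \<in> circle_borel \<Longrightarrow> measure (diag_measure F h) A = (norm (F A h))\<^sup>2"
  by (simp add: measure_def emeasure_diag_measure)

lemma diag_measure_eqI:
  assumes "\<And>A. A \<in> circle_borel \<Longrightarrow> norm (F A h) = norm (F A g)"
  shows "diag_measure F h = diag_measure F g"
  using assms by (intro measure_eqI) (simp_all add: emeasure_diag_measure)

lemma AE_diag_measure:
  assumes B: "B \<in> circle_borel" and h: "F B h = h"
  shows "AE \<zeta> in diag_measure F h. \<zeta> \<in> B"
proof (rule AE_I)
  have N: "unit_circle - B \<in> circle_borel"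
    using B by (auto simp: circle_borel_iff)
  then show "unit_circle - B \<in> sets (diag_measure F h)"
    by simp
  show "emeasure (diag_measure F h) (unit_circle - B) = 0"
    using N B h by (simp add: emeasure_diag_measure F_Compl)
qed auto

lemma U_spectral_integral: "cinner (U h) g = spectral_integral F (\<lambda>\<zeta>. \<zeta>) h g"
  using spectral by (simp add: spectral_measure_of_unitary_def)

text \<open>The polarized integral is evaluated at \<open>h / 2\<close>, whose multiples by \<open>1 + \<i>\<^sup>k\<close> are \<open>h\<close>, \<open>0\<close>, and two
  vectors that induce the same measure and enter with opposite signs.\<close>

lemma cinner_U_self: "cinner (U h) h = (LINT \<zeta>|diag_measure F h. \<zeta>)"
proof -
  define u where "u = (1/2 :: complex) *\<^sub>C h"
  define I where "I x = (LINT \<zeta>|diag_measure F x. \<zeta>)" for x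
  have mult: "u + (c :: complex) *\<^sub>C u = (1 + c) *\<^sub>C u" for c
    by (simp add: scaleC_add_left scaleC_one)
  have "I (0 *\<^sub>C u) = 0"
    unfolding I_def
  proof (rule integral_eq_zero_AE, rule emeasure_0_AE)
    show "emeasure (diag_measure F (0 *\<^sub>C u)) (space (diag_measure F (0 *\<^sub>C u))) = 0"
      by (simp add: emeasure_diag_measure circle_borel_iff F_circle)
  qed
  moreover have "diag_measure F ((1 + \<i>) *\<^sub>C u) = diag_measure F ((1 - \<i>) *\<^sub>C u)"
    by (rule diag_measure_eqI) (simp add: F_scaleC norm_scaleC cmod_def)
  then have "I ((1 + \<i>) *\<^sub>C u) = I ((1 - \<i>) *\<^sub>C u)"
    by (simp add: I_def)
  moreover have "2 *\<^sub>C u = h" "h = (2 :: complex) *\<^sub>C u"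
    by (simp_all add: u_def scaleC_scaleC scaleC_one)
  moreover have "\<i> ^ 3 = - \<i>"
    by (simp add: power3_eq_cube)
  ultimately have "4 * cinner (U u) u = I h"
    unfolding U_spectral_integral spectral_integral_def mult I_def[symmetric]
    by (simp add: numeral_eq_Suc[of "num.Bit0 (num.Bit0 num.One)"] lessThan_Suc power2_eq_square numeral_3_eq_3)
  moreover have "cinner (U h) h = 4 * cinner (U u) u"
    by (simp add: \<open>h = 2 *\<^sub>C u\<close> U_scaleC cinner_scaleC_left cinner_scaleC_right)
  ultimately show ?thesis
    by (simp add: I_def)
qed

text \<open>If \<open>F A x = x\<close> and \<open>F A y = 0\<close>, the measure of \<open>x + \<i>\<^sup>k y\<close> does not depend on \<open>k\<close>, so the four
  terms of the polarized integral cancel.\<close>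

lemma cinner_U_eq_0:
  assumes A: "A \<in> circle_borel" and x: "F A x = x" and y: "F A y = 0"
  shows "cinner (U x) y = 0"
proof -
  have diag: "diag_measure F (x + c *\<^sub>C y) = diag_measure F (x + y)" if "cmod c = 1" for c
  proof (rule diag_measure_eqI)
    fix B assume B: "B \<in> circle_borel"
    have "cinner (F B x) (F B y) = cinner (F B x) y"
      by (metis B F_idem F_self_adjoint)
    also have "\<dots> = cinner (F A (F B x)) y"
      using A B x by (metis F_Int Int_commute)
    also have "\<dots> = 0"
      using A y by (simp add: F_self_adjoint)
    finally have "cinner (F B x) (F B y) = 0" .
    then have "(norm (F B (x + c *\<^sub>C y)))\<^sup>2 = (norm (F B (x + y)))\<^sup>2"
      using B that by (simp add: F_add F_scaleC norm_add_sq norm_scaleC cinner_scaleC_right)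
    then show "norm (F B (x + c *\<^sub>C y)) = norm (F B (x + y))"
      by simp
  qed
  have "spectral_integral F (\<lambda>\<zeta>. \<zeta>) x y
      = (\<Sum>k<4. \<i> ^ k * (LINT \<zeta>|diag_measure F (x + y). \<zeta>)) / 4"
    unfolding spectral_integral_def by (simp add: diag norm_power)
  also have "(\<Sum>k<4. \<i> ^ k * (LINT \<zeta>|diag_measure F (x + y). \<zeta>)) = 0"
    by (simp add: numeral_eq_Suc lessThan_Suc)
  finally show ?thesis
    by (simp add: U_spectral_integral)
qed

text \<open>By the preceding lemma \<open>U x\<close> is orthogonal to the component of \<open>U x\<close> outside the range of \<open>F A\<close>.\<close>

lemma F_U_fixed:
  assumes A: "A \<in> circle_borel" and x: "F A x = x"
  shows "F A (U x) = U x"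
proof -
  define e where "e = U x - F A (U x)"
  have e: "F A e = 0"
    using A by (simp add: e_def F_diff F_idem)
  have "cinner e e = cinner (U x) e - cinner (F A (U x)) e"
    by (subst (1) e_def) (simp add: cinner_diff_left)
  also have "\<dots> = 0"
    using A x e by (simp add: cinner_U_eq_0 F_self_adjoint)
  finally show ?thesis
    by (simp add: cinner_eq_zero_iff e_def)
qed

text \<open>The range and the kernel of \<open>F A\<close> are both invariant under \<open>U\<close>, the kernel being the range of \<open>F\<close> of
  the complement.\<close>

lemma F_commutes_U:
  assumes A: "A \<in> circle_borel"
  shows "F A (U x) = U (F A x)"
proof -
  define y where "y = x - F A x"
  have "unit_circle - A \<in> circle_borel"
    using A by (auto simp: circle_borel_iff)
  moreover have "F (unit_circle - A) y = y"
    using A by (simp add: F_fixed_Compl y_def F_diff F_idem)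
  ultimately have "F (unit_circle - A) (U y) = U y"
    by (rule F_U_fixed)
  then have "F A (U y) = 0"
    using A by (simp add: F_fixed_Compl)
  moreover have "F A (U (F A x)) = U (F A x)"
    by (intro F_U_fixed A F_idem)
  moreover have "U x = U (F A x) + U y"
    by (simp add: y_def U_diff)
  ultimately show ?thesis
    using A by (simp add: F_add)
qed

text \<open>For \<open>\<bar>\<zeta>\<bar> = 1\<close> the integrand equals \<open>1 + \<bar>z\<bar>\<^sup>2 - 2 Re (z \<zeta>)\<close>, and the left-hand side expands in the same
  way, with \<open>\<langle>U x, x\<rangle>\<close> in place of \<open>\<zeta>\<close>.\<close>

lemma norm_resolvent_sq:
  "(norm (x - z *\<^sub>C U x))\<^sup>2 = (LINT \<zeta>|diag_measure F x. (cmod (1 - z * \<zeta>))\<^sup>2)"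
proof -
  interpret finite_measure "diag_measure F x"
    by (rule finite_diag_measure)
  have int_id: "integrable (diag_measure F x) (\<lambda>\<zeta>. \<zeta>)"
    by (intro integrable_circle finite_diag_measure) (simp_all add: continuous_on_id)
  have "(LINT \<zeta>|diag_measure F x. (cmod (1 - z * \<zeta>))\<^sup>2)
      = (LINT \<zeta>|diag_measure F x. (1 + (cmod z)\<^sup>2) - 2 * Re (z * \<zeta>))"
  proof (rule Bochner_Integration.integral_cong[OF refl])
    fix \<zeta> assume "\<zeta> \<in> space (diag_measure F x)"
    then have "(Re \<zeta>)\<^sup>2 + (Im \<zeta>)\<^sup>2 = 1"
      by (simp add: cmod_def)
    moreover have "(cmod z)\<^sup>2 * ((Re \<zeta>)\<^sup>2 + (Im \<zeta>)\<^sup>2) = (Re (z * \<zeta>))\<^sup>2 + (Im (z * \<zeta>))\<^sup>2"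
      by (simp add: cmod_power2) (simp add: power2_eq_square algebra_simps)
    ultimately show "(cmod (1 - z * \<zeta>))\<^sup>2 = (1 + (cmod z)\<^sup>2) - 2 * Re (z * \<zeta>)"
      by (simp add: cmod_power2[of "1 - z * \<zeta>"] power2_diff del: times_complex.sel)
  qed
  also have "\<dots> = (1 + (cmod z)\<^sup>2) * measure (diag_measure F x) unit_circle
      - 2 * Re (z * (LINT \<zeta>|diag_measure F x. \<zeta>))"
    using int_id by (simp del: times_complex.sel add: integral_diff)
  also have "measure (diag_measure F x) unit_circle = (norm x)\<^sup>2"
    by (simp add: measure_diag_measure circle_borel_iff F_circle)
  also have "z * (LINT \<zeta>|diag_measure F x. \<zeta>) = cinner (z *\<^sub>C U x) x"
    by (simp only: cinner_scaleC_left cinner_U_self)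
  also have "(1 + (cmod z)\<^sup>2) * (norm x)\<^sup>2 - 2 * Re (cinner (z *\<^sub>C U x) x)
      = (norm (x - z *\<^sub>C U x))\<^sup>2"
    using Re_cinner_commute[of x "z *\<^sub>C U x"]
    by (simp add: norm_diff_sq norm_scaleC power_mult_distrib algebra_simps)
  finally show ?thesis ..
qed

lemma
  assumes B: "B \<in> circle_borel" and x: "F B x = x" and c: "c \<ge> 0"
  shows resolvent_lower_bound:
      "(\<And>\<zeta>. \<zeta> \<in> B \<Longrightarrow> c \<le> cmod (1 - z * \<zeta>)) \<Longrightarrow> c * norm x \<le> norm (x - z *\<^sub>C U x)"
    and resolvent_upper_bound:
      "(\<And>\<zeta>. \<zeta> \<in> B \<Longrightarrow> cmod (1 - z * \<zeta>) \<le> c) \<Longrightarrow> norm (x - z *\<^sub>C U x) \<le> c * norm x"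
proof -
  interpret finite_measure "diag_measure F x"
    by (rule finite_diag_measure)
  have int: "integrable (diag_measure F x) (\<lambda>\<zeta>. (cmod (1 - z * \<zeta>))\<^sup>2)"
    by (intro integrable_circle finite_diag_measure) (auto intro!: continuous_intros)
  have const: "(LINT \<zeta>|diag_measure F x. c\<^sup>2) = (c * norm x)\<^sup>2"
    by (simp add: measure_diag_measure circle_borel_iff F_circle power_mult_distrib)
  show "c * norm x \<le> norm (x - z *\<^sub>C U x)" if "\<And>\<zeta>. \<zeta> \<in> B \<Longrightarrow> c \<le> cmod (1 - z * \<zeta>)"
  proof (rule power2_le_imp_le)
    show "(c * norm x)\<^sup>2 \<le> (norm (x - z *\<^sub>C U x))\<^sup>2"
      unfolding norm_resolvent_sq const[symmetric]
      using int AE_diag_measure[OF B x]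
      by (intro integral_mono_AE) (auto elim!: eventually_mono intro!: power_mono that c)
  qed simp
  show "norm (x - z *\<^sub>C U x) \<le> c * norm x" if "\<And>\<zeta>. \<zeta> \<in> B \<Longrightarrow> cmod (1 - z * \<zeta>) \<le> c"
  proof (rule power2_le_imp_le)
    show "(norm (x - z *\<^sub>C U x))\<^sup>2 \<le> (c * norm x)\<^sup>2"
      unfolding norm_resolvent_sq const[symmetric]
      using int AE_diag_measure[OF B x]
      by (intro integral_mono_AE) (auto elim!: eventually_mono intro!: power_mono that)
  qed (use c in simp)
qed

end

section \<open>The resolvent on invariant subspaces\<close>

context spectral_unitary
begin

text \<open>Invertibility of \<open>1 - z U\<close> on an invariant subspace persists while \<open>z\<close> moves by less than the
  lower bound: the equation at \<open>w\<close> is a fixed-point equation for a contraction built from the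
  inverse at \<open>z\<close>.\<close>

lemma resolvent_exists_nearby:
  assumes M: "closed_csubspace M" and inv: "\<And>y. y \<in> M \<Longrightarrow> U y \<in> M"
    and lower: "\<And>x. x \<in> M \<Longrightarrow> c * norm x \<le> norm (x - z *\<^sub>C U x)"
    and exists: "\<And>h. h \<in> M \<Longrightarrow> \<exists>x\<in>M. x - z *\<^sub>C U x = h"
    and w: "cmod (w - z) < c" and h: "h \<in> M"
  shows "\<exists>x\<in>M. x - w *\<^sub>C U x = h"
proof -
  have sub: "complex_vector.subspace M" and cl: "closed M"
    using M by (auto simp: closed_csubspace_def)
  have "c > 0"
    using w norm_ge_zero[of "w - z"] by linarith
  obtain R where R: "\<And>y. y \<in> M \<Longrightarrow> R y \<in> M" "\<And>y. y \<in> M \<Longrightarrow> R y - z *\<^sub>C U (R y) = y"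
    using exists by metis
  \<comment> \<open>The equation \<open>x - w U x = h\<close> reads \<open>x - z U x = h + (w - z) U x\<close>.\<close>
  define f where "f x = R (h + (w - z) *\<^sub>C U x)" for x
  have arg: "h + (w - z) *\<^sub>C U x \<in> M" if "x \<in> M" for x
    by (rule complex_vector.subspace_add[OF sub h complex_vector.subspace_scale[OF sub inv[OF that]]])
  have "\<exists>!x\<in>M. f x = x"
  proof (rule Banach_fix[where c = "cmod (w - z) / c"])
    show "complete M"
      using cl by (simp add: complete_eq_closed)
    show "M \<noteq> {}" "0 \<le> cmod (w - z) / c" "cmod (w - z) / c < 1"
      using h w \<open>c > 0\<close> by auto
    show "f ` M \<subseteq> M"
      using R(1) arg by (auto simp: f_def)
    fix x y assume xy: "x \<in> M" "y \<in> M"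
    have "f x - f y \<in> M"
      unfolding f_def by (intro complex_vector.subspace_diff[OF sub] R(1) arg xy)
    then have "c * norm (f x - f y) \<le> norm ((f x - f y) - z *\<^sub>C U (f x - f y))"
      by (rule lower)
    also have "(f x - f y) - z *\<^sub>C U (f x - f y)
        = (f x - z *\<^sub>C U (f x)) - (f y - z *\<^sub>C U (f y))"
      by (simp add: U_diff complex_vector.scale_right_diff_distrib)
    also have "\<dots> = (w - z) *\<^sub>C U (x - y)"
      using R(2)[OF arg] xy by (simp add: f_def U_diff complex_vector.scale_right_diff_distrib)
    also have "norm \<dots> = cmod (w - z) * norm (x - y)"
      by (simp only: norm_scaleC norm_U)
    finally show "dist (f x) (f y) \<le> cmod (w - z) / c * dist x y"
      using \<open>c > 0\<close> by (simp add: dist_norm pos_le_divide_eq mult.commute)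
  qed
  then obtain x where x: "x \<in> M" "f x = x"
    by blast
  then have "x - z *\<^sub>C U x = h + (w - z) *\<^sub>C U x"
    using R(2)[OF arg[OF x(1)]] by (simp add: f_def)
  then have "x - w *\<^sub>C U x = h"
    by (simp add: complex_vector.scale_left_diff_distrib algebra_simps)
  then show ?thesis
    using x(1) by blast
qed

lemma resolvent_lower_bound_off_circle: "\<bar>1 - cmod z\<bar> * norm x \<le> norm (x - z *\<^sub>C U x)"
proof -
  have "\<bar>norm x - norm (z *\<^sub>C U x)\<bar> \<le> norm (x - z *\<^sub>C U x)"
    by (rule norm_triangle_ineq3)
  moreover have "norm x - norm (z *\<^sub>C U x) = (1 - cmod z) * norm x"
    by (simp add: norm_scaleC algebra_simps)
  ultimately show ?thesis
    by (simp add: abs_mult)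
qed

text \<open>Inside the disc this continues from \<open>z = 0\<close>; outside, \<open>x - z U x = h\<close> is the fixed-point
  equation \<open>x = z\<^sup>-\<^sup>1 U\<^sup>-\<^sup>1 (x - h)\<close>.\<close>

lemma resolvent_exists_off_circle:
  assumes M: "closed_csubspace M" and inv: "\<And>y. U y \<in> M \<longleftrightarrow> y \<in> M"
    and z: "cmod z \<noteq> 1" and h: "h \<in> M"
  shows "\<exists>x\<in>M. x - z *\<^sub>C U x = h"
proof (cases "cmod z < 1")
  case True
  show ?thesis
  proof (rule resolvent_exists_nearby[OF M, where z = 0 and c = 1])
    show "\<exists>x\<in>M. x - 0 *\<^sub>C U x = g" if "g \<in> M" for g
      using that by (intro bexI[of _ g]) simp_all
  qed (use inv True h in simp_all)
next
  case False
  have sub: "complex_vector.subspace M" and cl: "closed M"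
    using M by (auto simp: closed_csubspace_def)
  have z1: "cmod z > 1" and z0: "z \<noteq> 0"
    using False z by auto
  obtain V where V: "\<And>y. U (V y) = y"
    using U_surj by metis
  define f where "f x = inverse z *\<^sub>C V (x - h)" for x
  have "\<exists>!x\<in>M. f x = x"
  proof (rule Banach_fix[where c = "inverse (cmod z)"])
    show "complete M"
      using cl by (simp add: complete_eq_closed)
    show "M \<noteq> {}" "0 \<le> inverse (cmod z)" "inverse (cmod z) < 1"
      using h z1 by (auto simp: inverse_less_1_iff)
    have "f x \<in> M" if "x \<in> M" for x
    proof -
      have "U (V (x - h)) \<in> M"
        using complex_vector.subspace_diff[OF sub that h] by (simp add: V)
      then show ?thesis
        unfolding f_def inv by (rule complex_vector.subspace_scale[OF sub])
    qed
    then show "f ` M \<subseteq> M"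
      by blast
    fix x y
    have "norm (V (x - h) - V (y - h)) = norm (U (V (x - h) - V (y - h)))"
      by simp
    also have "\<dots> = norm (x - y)"
      by (simp add: U_diff V)
    finally show "dist (f x) (f y) \<le> inverse (cmod z) * dist x y"
      by (simp add: dist_norm f_def norm_scaleC norm_inverse
          complex_vector.scale_right_diff_distrib[symmetric])
  qed
  then obtain x where x: "x \<in> M" "x = f x"
    by metis
  have "z *\<^sub>C U x = x - h"
    by (subst x(2)) (simp add: f_def U_scaleC V scaleC_scaleC scaleC_one z0)
  then show ?thesis
    using x(1) by (intro bexI[of _ x]) simp_all
qed

lemma inv_resolvent:
  assumes "cmod z \<noteq> 1"
  shows "inv (\<lambda>x. x - z *\<^sub>C U x) h = x \<longleftrightarrow> x - z *\<^sub>C U x = h"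
proof -
  have inj: "x = y" if "x - z *\<^sub>C U x = y - z *\<^sub>C U y" for x y
  proof -
    have "(x - y) - z *\<^sub>C U (x - y) = 0"
      using that by (simp add: U_diff complex_vector.scale_right_diff_distrib algebra_simps)
    then have "\<bar>1 - cmod z\<bar> * norm (x - y) \<le> 0"
      using resolvent_lower_bound_off_circle[of z "x - y"] by simp
    then show ?thesis
      using assms by (simp add: mult_le_0_iff)
  qed
  have "closed_csubspace (UNIV :: 'a set)"
    by (simp add: closed_csubspace_def complex_vector.subspace_UNIV)
  then have "\<exists>x. x - z *\<^sub>C U x = h"
    using resolvent_exists_off_circle[of UNIV z h] assms by auto
  then have "(\<lambda>x. x - z *\<^sub>C U x) (inv (\<lambda>x. x - z *\<^sub>C U x) h) = h"
    by (intro f_inv_into_f) auto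
  then show ?thesis
    using inj by metis
qed

text \<open>With \<open>T z = P\<^sub>H (1 - z U)\<^sup>-\<^sup>1\<close> on \<open>M\<close>, the resolvent identity
  \<open>(1 - w U)\<^sup>-\<^sup>1 - (1 - z U)\<^sup>-\<^sup>1 = (w - z) (1 - w U)\<^sup>-\<^sup>1 U (1 - z U)\<^sup>-\<^sup>1\<close> exhibits
  \<open>P\<^sub>H (1 - z U)\<^sup>-\<^sup>1 U (1 - z U)\<^sup>-\<^sup>1\<close> as the derivative at \<open>z\<close>.\<close>

lemma resolvent_analytic:
  assumes M: "closed_csubspace M" and inv: "\<And>y. y \<in> M \<Longrightarrow> U y \<in> M"
    and H: "closed_csubspace H" and HM: "H \<subseteq> M" and S: "open S"
    and lower: "\<And>z. z \<in> S \<Longrightarrow> \<exists>c>0. \<forall>x\<in>M. c * norm x \<le> norm (x - z *\<^sub>C U x)"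
    and R: "\<And>z h. z \<in> S \<Longrightarrow> h \<in> M \<Longrightarrow> R z h \<in> M"
      "\<And>z h. z \<in> S \<Longrightarrow> h \<in> M \<Longrightarrow> R z h - z *\<^sub>C U (R z h) = h"
  shows "operator_analytic_on H (\<lambda>z h. orth_proj H (R z h)) S"
proof -
  have subM: "complex_vector.subspace M" and subH: "complex_vector.subspace H"
    using M H by (auto simp: closed_csubspace_def)
  note M_add = complex_vector.subspace_add[OF subM]
    and M_diff = complex_vector.subspace_diff[OF subM]
    and M_scale = complex_vector.subspace_scale[OF subM]
  have R_eqI: "R z h = x" if z: "z \<in> S" and x: "x \<in> M" and h: "x - z *\<^sub>C U x = h" for z h x
  proof -
    obtain c where c: "c > 0" "\<forall>x\<in>M. c * norm x \<le> norm (x - z *\<^sub>C U x)"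
      using lower[OF z] by blast
    have hM: "h \<in> M"
      unfolding h[symmetric] by (intro M_diff M_scale inv x)
    have "(R z h - x) - z *\<^sub>C U (R z h - x) = (R z h - z *\<^sub>C U (R z h)) - (x - z *\<^sub>C U x)"
      by (simp add: U_diff complex_vector.scale_right_diff_distrib)
    then have "(R z h - x) - z *\<^sub>C U (R z h - x) = 0"
      by (simp only: R(2)[OF z hM] h diff_self)
    then have "c * norm (R z h - x) \<le> 0"
      using c(2) M_diff[OF R(1)[OF z hM] x] by fastforce
    then show ?thesis
      using c(1) by (simp add: mult_le_0_iff)
  qed
  have R_add: "R z (x + y) = R z x + R z y" if "z \<in> S" "x \<in> M" "y \<in> M" for z x y
  proof (intro R_eqI M_add R(1) that)
    have "R z x + R z y - z *\<^sub>C U (R z x + R z y)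
        = (R z x - z *\<^sub>C U (R z x)) + (R z y - z *\<^sub>C U (R z y))"
      by (simp add: U_add complex_vector.scale_right_distrib)
    then show "R z x + R z y - z *\<^sub>C U (R z x + R z y) = x + y"
      using that by (simp only: R(2))
  qed
  have R_scale: "R z (c *\<^sub>C x) = c *\<^sub>C R z x" if "z \<in> S" "x \<in> M" for z c x
  proof (intro R_eqI M_scale R(1) that)
    have "c *\<^sub>C R z x - z *\<^sub>C U (c *\<^sub>C R z x) = c *\<^sub>C (R z x - z *\<^sub>C U (R z x))"
      by (simp add: U_scaleC scaleC_scaleC complex_vector.scale_right_diff_distrib mult.commute)
    then show "c *\<^sub>C R z x - z *\<^sub>C U (c *\<^sub>C R z x) = c *\<^sub>C x"
      using that by (simp add: R(2))
  qed
  have R_bound: "c * norm (R z h) \<le> norm h"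
    if "z \<in> S" "h \<in> M" "\<forall>x\<in>M. c * norm x \<le> norm (x - z *\<^sub>C U x)" for z c h
    using that R(1)[OF that(1,2)] R(2)[OF that(1,2)] by fastforce
  have resolvent_identity: "R w h - R z h = (w - z) *\<^sub>C R w (U (R z h))"
    if "w \<in> S" "z \<in> S" "h \<in> M" for w z h
  proof -
    have zM: "R z h \<in> M" "U (R z h) \<in> M"
      using that by (auto intro: R(1) inv)
    have "R w h = R z h + (w - z) *\<^sub>C R w (U (R z h))"
    proof (rule R_eqI[OF that(1)])
      show "R z h + (w - z) *\<^sub>C R w (U (R z h)) \<in> M"
        by (intro M_add M_scale R(1) zM that)
      have "R z h + (w - z) *\<^sub>C R w (U (R z h)) - w *\<^sub>C U (R z h + (w - z) *\<^sub>C R w (U (R z h)))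
        = (R z h - w *\<^sub>C U (R z h))
          + (w - z) *\<^sub>C (R w (U (R z h)) - w *\<^sub>C U (R w (U (R z h))))"
        by (simp add: U_add U_scaleC scaleC_scaleC complex_vector.scale_right_distrib
            complex_vector.scale_right_diff_distrib mult.commute)
      also have "\<dots> = R z h - z *\<^sub>C U (R z h)"
        using that zM by (simp add: R(2) complex_vector.scale_left_diff_distrib)
      finally show "R z h + (w - z) *\<^sub>C R w (U (R z h))
          - w *\<^sub>C U (R z h + (w - z) *\<^sub>C R w (U (R z h))) = h"
        using that by (simp add: R(2))
    qed
    then show ?thesis
      by simp
  qed
  have bounded: "bounded_operator_on H (\<lambda>h. orth_proj H (A h))"
    if "\<And>x y. x \<in> M \<Longrightarrow> y \<in> M \<Longrightarrow> A (x + y) = A x + A y"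
      "\<And>c x. x \<in> M \<Longrightarrow> A (c *\<^sub>C x) = c *\<^sub>C A x"
      "\<And>h. h \<in> M \<Longrightarrow> norm (A h) \<le> K * norm h" for A K
    unfolding bounded_operator_on_def clinear_on_def
    using HM that
    by (auto simp: subset_iff orth_proj_add[OF H] orth_proj_scaleC[OF H] orth_proj_in[OF H]
        intro!: exI[of _ K] order_trans[OF norm_orth_proj_le[OF H]])
  have R_norm: "norm (R z h) \<le> norm h / c"
    if "z \<in> S" "h \<in> M" "\<forall>x\<in>M. c * norm x \<le> norm (x - z *\<^sub>C U x)" "c > 0" for z c h
    using R_bound[OF that(1-3)] that(4) by (simp add: field_simps)
  show ?thesis
    unfolding operator_analytic_on_def
  proof (intro conjI ballI)
    show "open S" by fact
  next
    fix z assume z: "z \<in> S"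
    obtain c where c: "c > 0" "\<forall>x\<in>M. c * norm x \<le> norm (x - z *\<^sub>C U x)"
      using lower[OF z] by blast
    have "norm (R z h) \<le> (1 / c) * norm h" if "h \<in> M" for h
      using R_norm[OF z that c(2,1)] by simp
    then show "bounded_operator_on H (\<lambda>h. orth_proj H (R z h))"
      by (intro bounded[of "R z" "1 / c"] R_add R_scale z)
    define D where "D h = R z (U (R z h))" for h
    have D_norm: "norm (D h) \<le> (1 / c\<^sup>2) * norm h" if "h \<in> M" for h
    proof -
      have "norm (D h) \<le> norm (R z h) / c"
        using R_norm[OF z inv[OF R(1)[OF z that]] c(2,1)] by (simp add: D_def)
      also have "\<dots> \<le> (norm h / c) / c"
        using c(1) by (intro divide_right_mono R_norm z that c) simp
      finally show ?thesis
        by (simp add: power2_eq_square)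
    qed
    have "bounded_operator_on H (\<lambda>h. orth_proj H (D h))"
    proof (rule bounded[OF _ _ D_norm])
      show "D (x + y) = D x + D y" if "x \<in> M" "y \<in> M" for x y
        using that z by (simp add: D_def R_add U_add R(1) inv)
      show "D (a *\<^sub>C x) = a *\<^sub>C D x" if "x \<in> M" for a x
        using that z by (simp add: D_def R_scale U_scaleC R(1) inv)
    qed
    moreover have "uniform_limit {h \<in> H. norm h \<le> 1}
        (\<lambda>w h. inverse (w - z) *\<^sub>C (orth_proj H (R w h) - orth_proj H (R z h)))
        (\<lambda>h. orth_proj H (D h)) (at z)"
    proof (rule uniform_limitI)
      fix e :: real assume e: "e > 0"
      \<comment> \<open>For \<open>\<bar>w - z\<bar> < c / 2\<close> the lower bound \<open>c\<close> at \<open>z\<close> leaves the lower bound \<open>c / 2\<close> at \<open>w\<close>, so that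
        the error \<open>(w - z) R\<^sub>w U R\<^sub>z U R\<^sub>z h\<close> of the difference quotient is at most \<open>\<bar>w - z\<bar> 2 / c\<^sup>3\<close>.\<close>
      define d where "d = min (c / 2) (e * c ^ 3 / 2)"
      have d: "d > 0" "d \<le> c / 2" "d \<le> e * c ^ 3 / 2"
        using c(1) e by (auto simp: d_def)
      have "\<forall>\<^sub>F w in at z. w \<in> S"
        by (rule eventually_at_in_open'[OF S z])
      moreover have "\<forall>\<^sub>F w in at z. 0 < dist w z \<and> dist w z < d"
        unfolding eventually_at using d(1) by auto
      ultimately show "\<forall>\<^sub>F w in at z. \<forall>h\<in>{h \<in> H. norm h \<le> 1}.
          dist (inverse (w - z) *\<^sub>C (orth_proj H (R w h) - orth_proj H (R z h)))
            (orth_proj H (D h)) < e"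
      proof (eventually_elim, intro ballI)
        fix w h
        assume w: "w \<in> S" "0 < dist w z \<and> dist w z < d" and h: "h \<in> {h \<in> H. norm h \<le> 1}"
        have hM: "h \<in> M" and h1: "norm h \<le> 1"
          using h HM by auto
        have wz: "w - z \<noteq> 0" "cmod (w - z) < d"
          using w(2) by (auto simp: dist_norm)
        have lower_w: "\<forall>x\<in>M. c / 2 * norm x \<le> norm (x - w *\<^sub>C U x)"
        proof
          fix x assume "x \<in> M"
          have "x - w *\<^sub>C U x = (x - z *\<^sub>C U x) - (w - z) *\<^sub>C U x"
            by (simp add: complex_vector.scale_left_diff_distrib)
          then have "norm (x - z *\<^sub>C U x) - norm ((w - z) *\<^sub>C U x) \<le> norm (x - w *\<^sub>C U x)"
            by (simp only: norm_triangle_ineq2)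
          then have "norm (x - z *\<^sub>C U x) - cmod (w - z) * norm x \<le> norm (x - w *\<^sub>C U x)"
            by (simp only: norm_scaleC norm_U)
          moreover have "c * norm x \<le> norm (x - z *\<^sub>C U x)"
            using c(2) \<open>x \<in> M\<close> by blast
          moreover have "cmod (w - z) * norm x \<le> c / 2 * norm x"
            using wz(2) d(2) by (intro mult_right_mono) auto
          ultimately show "c / 2 * norm x \<le> norm (x - w *\<^sub>C U x)"
            by simp
        qed
        define y where "y = U (R z h)"
        have y: "y \<in> M"
          using hM z by (simp add: y_def R(1) inv)
        have "inverse (w - z) *\<^sub>C (orth_proj H (R w h) - orth_proj H (R z h)) - orth_proj H (D h)
            = orth_proj H (inverse (w - z) *\<^sub>C (R w h - R z h) - D h)"
          using orth_proj_add[OF H, of "R w h - R z h" "R z h"]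
            orth_proj_add[OF H, of "inverse (w - z) *\<^sub>C (R w h - R z h) - D h" "D h"]
          by (simp add: orth_proj_scaleC[OF H])
        also have "inverse (w - z) *\<^sub>C (R w h - R z h) - D h = R w y - R z y"
          using wz(1) resolvent_identity[OF w(1) z hM]
          by (simp add: scaleC_scaleC scaleC_one D_def y_def)
        also have "\<dots> = (w - z) *\<^sub>C R w (U (R z y))"
          by (rule resolvent_identity[OF w(1) z y])
        finally have "dist (inverse (w - z) *\<^sub>C (orth_proj H (R w h) - orth_proj H (R z h)))
            (orth_proj H (D h)) = norm (orth_proj H ((w - z) *\<^sub>C R w (U (R z y))))"
          by (simp only: dist_norm)
        also have "\<dots> \<le> norm ((w - z) *\<^sub>C R w (U (R z y)))"
          by (rule norm_orth_proj_le[OF H])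
        also have "\<dots> \<le> cmod (w - z) * (2 / c ^ 3)"
        proof -
          have "norm (R w (U (R z y))) \<le> norm (R z y) / (c / 2)"
            using R_norm[OF w(1) inv[OF R(1)[OF z y]] lower_w] c(1) by simp
          also have "\<dots> \<le> norm y / c / (c / 2)"
            using c(1) by (intro divide_right_mono R_norm z y c) simp
          also have "norm y = norm (R z h)"
            by (simp add: y_def)
          also have "norm (R z h) / c / (c / 2) \<le> norm h / c / c / (c / 2)"
            using c(1) by (intro divide_right_mono R_norm z hM c) simp_all
          also have "\<dots> \<le> 1 / c / c / (c / 2)"
            using h1 c(1) by (intro divide_right_mono) simp_all
          also have "\<dots> = 2 / c ^ 3"
            by (simp add: power3_eq_cube)
          finally show ?thesis
            unfolding norm_scaleC by (rule mult_left_mono) simp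
        qed
        also have "\<dots> < d * (2 / c ^ 3)"
          using wz(2) c(1) by (intro mult_strict_right_mono) simp_all
        also have "\<dots> \<le> e * c ^ 3 / 2 * (2 / c ^ 3)"
          using d(3) c(1) by (intro mult_right_mono) simp_all
        also have "\<dots> = e"
          using c(1) by simp
        finally show "dist (inverse (w - z) *\<^sub>C (orth_proj H (R w h) - orth_proj H (R z h)))
            (orth_proj H (D h)) < e" .
      qed
    qed
    ultimately show "\<exists>T'. bounded_operator_on H T' \<and> uniform_limit {h \<in> H. norm h \<le> 1}
        (\<lambda>w h. inverse (w - z) *\<^sub>C (orth_proj H (R w h) - orth_proj H (R z h))) T' (at z)"
      by blast
  qed
qed

end

section \<open>Arcs of the unit circle\<close>

text \<open>If \<open>b > a + 2 \<pi>\<close>, the arc covers the circle and both sides are empty.\<close>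

lemma unit_circle_diff_arc:
  "unit_circle - cis ` {a<..<b} = cis ` {b..a + 2 * pi}"
proof (intro equalityI subsetI)
  fix \<zeta> assume \<zeta>: "\<zeta> \<in> unit_circle - cis ` {a<..<b}"
  define n where "n = \<lfloor>(a - Arg \<zeta>) / (2 * pi)\<rfloor>"
  define t where "t = Arg \<zeta> + 2 * pi * (n + 1)"
  have "of_int n \<le> (a - Arg \<zeta>) / (2 * pi)" "(a - Arg \<zeta>) / (2 * pi) < of_int n + 1"
    unfolding n_def by linarith+
  then have t: "a < t" "t \<le> a + 2 * pi"
    by (simp_all add: t_def field_simps)
  have "cis t = cis (Arg \<zeta>)"
    unfolding complex_eq_iff cis.sel using sin_cos_eq_iff[of t "Arg \<zeta>"] t_def
    by (metis of_int_add of_int_1)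
  also have "\<dots> = \<zeta>"
    using \<zeta> rcis_cmod_Arg[of \<zeta>] by (simp add: rcis_def)
  finally show "\<zeta> \<in> cis ` {b..a + 2 * pi}"
    using \<zeta> t by force
next
  fix \<zeta> assume "\<zeta> \<in> cis ` {b..a + 2 * pi}"
  then obtain t where t: "b \<le> t" "t \<le> a + 2 * pi" "\<zeta> = cis t"
    by auto
  have "\<zeta> \<noteq> cis s" if s: "a < s" "s < b" for s
  proof
    assume "\<zeta> = cis s"
    then obtain n :: int where n: "t = s + 2 * pi * n"
      using t(3) sin_cos_eq_iff[of t s] by (auto simp: complex_eq_iff)
    have "2 * pi * 0 < 2 * pi * n" "2 * pi * n < 2 * pi * 1"
      using n s t by linarith+
    then show False
      by (simp add: zero_less_mult_iff)
  qed
  then have "\<zeta> \<notin> cis ` {a<..<b}"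
    unfolding image_iff by (meson greaterThanLessThan_iff)
  moreover have "\<zeta> \<in> unit_circle"
    by (simp add: t(3))
  ultimately show "\<zeta> \<in> unit_circle - cis ` {a<..<b}"
    by blast
qed

lemma circle_cball_borel: "unit_circle \<inter> cball \<omega> \<epsilon> \<in> circle_borel"
  unfolding circle_borel_iff by (intro conjI sets.Int borel_closed) auto

lemma compact_cis_image: "compact (cis ` {s..t})"
  by (intro compact_continuous_image continuous_on_cis continuous_on_id compact_Icc)

lemma cis_image_borel: "cis ` {s..t} \<in> circle_borel"
  unfolding circle_borel_iff using compact_imp_closed[OF compact_cis_image] by auto

lemma
  assumes "open_arc \<Delta>"
  shows closed_diff_open_arc: "closed (unit_circle - \<Delta>)"
    and open_arc_borel: "\<Delta> \<in> circle_borel"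
proof -
  obtain a b where \<Delta>: "\<Delta> = cis ` {a<..<b}"
    using assms by (auto simp: open_arc_def)
  show "closed (unit_circle - \<Delta>)"
    unfolding \<Delta> unit_circle_diff_arc by (intro compact_imp_closed compact_cis_image)
  then have "unit_circle - (unit_circle - \<Delta>) \<in> sets borel"
    by (intro sets.Diff borel_closed) simp_all
  moreover have "\<Delta> \<subseteq> unit_circle"
    by (auto simp: \<Delta>)
  moreover from this have "unit_circle - (unit_circle - \<Delta>) = \<Delta>"
    by blast
  ultimately show "\<Delta> \<in> circle_borel"
    by (simp add: circle_borel_iff)
qed

lemma norm_cis_diff_le: "cmod (cis u - cis x) \<le> \<bar>u - x\<bar>"
proof -
  have "cis u - cis x = cis x * (cis (u - x) - 1)"
    by (simp add: right_diff_distrib cis_mult)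
  moreover have "cmod (cis (u - x) - 1) = 2 * \<bar>sin ((u - x) / 2)\<bar>"
    unfolding cis_conv_exp by (rule dist_exp_i_1)
  ultimately have "cmod (cis u - cis x) = 2 * \<bar>sin ((u - x) / 2)\<bar>"
    by (simp only: norm_mult norm_cis mult_1)
  also have "\<dots> \<le> 2 * \<bar>(u - x) / 2\<bar>"
    by (intro mult_left_mono abs_sin_x_le_abs_x) simp
  finally show ?thesis
    by simp
qed

text \<open>A measure whose density with respect to arc length vanishes at every point of an arc does not
  charge the arc: by bisection, each compact subarc \<open>cis ` {s..t}\<close> has measure at most \<open>\<eta> (t - s)\<close>, for
  every \<open>\<eta> > 0\<close>.\<close>

lemma null_arc_if_zero_density:
  assumes fin: "finite_measure N" and sets: "sets N = circle_borel"
    and density: "\<And>x \<eta>. a < x \<Longrightarrow> x < b \<Longrightarrow> 0 < \<eta> \<Longrightarrow>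
      \<forall>\<^sub>F \<epsilon> in at_right 0. measure N (unit_circle \<inter> cball (cis x) \<epsilon>) \<le> \<eta> * \<epsilon>"
  shows "measure N (cis ` {a<..<b}) = 0"
proof -
  interpret finite_measure N
    by (rule fin)
  have compact_null: "measure N (cis ` {s..t}) = 0" if st: "a < s" "s \<le> t" "t < b" for s t
  proof -
    have bound: "measure N (cis ` {s..t}) \<le> \<eta> * (t - s)" if \<eta>: "\<eta> > 0" for \<eta>
      using \<open>s \<le> t\<close>
    proof (induction rule: Bolzano)
      case (trans p q r)
      have "cis ` {p..r} \<subseteq> cis ` {p..q} \<union> cis ` {q..r}"
        by force
      then have "measure N (cis ` {p..r}) \<le> measure N (cis ` {p..q} \<union> cis ` {q..r})"
        using cis_image_borel by (intro finite_measure_mono) (simp_all only: sets sets.Un)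
      also have "\<dots> \<le> measure N (cis ` {p..q}) + measure N (cis ` {q..r})"
        using cis_image_borel by (intro measure_Un_le) (simp_all only: sets)
      also have "\<dots> \<le> \<eta> * (r - p)"
        using trans by (simp add: algebra_simps)
      finally show ?case .
    next
      case (local x)
      then have "\<forall>\<^sub>F \<epsilon> in at_right 0. measure N (unit_circle \<inter> cball (cis x) \<epsilon>) \<le> \<eta> * \<epsilon>"
        using st \<eta> by (intro density) simp_all
      then obtain d where d: "d > 0"
        "\<And>\<epsilon>. 0 < \<epsilon> \<Longrightarrow> \<epsilon> < d \<Longrightarrow> measure N (unit_circle \<inter> cball (cis x) \<epsilon>) \<le> \<eta> * \<epsilon>"
        unfolding eventually_at_right_field by auto
      have "measure N (cis ` {p..q}) \<le> \<eta> * (q - p)" if pq: "p \<le> x" "x \<le> q" "q - p < d" for p q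
      proof -
        \<comment> \<open>The radius \<open>q - p\<close> itself is not admissible when \<open>p = q\<close>, so it is approached from above.\<close>
        have "measure N (cis ` {p..q}) / \<eta> \<le> q - p"
        proof (rule dense_ge_bounded[OF pq(3)])
          fix \<epsilon> assume \<epsilon>: "q - p < \<epsilon>" "\<epsilon> < d"
          have "cis ` {p..q} \<subseteq> unit_circle \<inter> cball (cis x) \<epsilon>"
          proof
            fix \<zeta> assume "\<zeta> \<in> cis ` {p..q}"
            then obtain u where u: "\<zeta> = cis u" "p \<le> u" "u \<le> q"
              by auto
            have "dist (cis x) \<zeta> \<le> \<bar>x - u\<bar>"
              unfolding u dist_norm by (rule norm_cis_diff_le)
            also have "\<dots> \<le> \<epsilon>"
              using u pq \<epsilon> by linarith
            finally show "\<zeta> \<in> unit_circle \<inter> cball (cis x) \<epsilon>"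
              by (simp add: u)
          qed
          then have "measure N (cis ` {p..q}) \<le> measure N (unit_circle \<inter> cball (cis x) \<epsilon>)"
            by (intro finite_measure_mono) (simp_all only: sets circle_cball_borel)
          also have "\<dots> \<le> \<eta> * \<epsilon>"
            using \<epsilon> pq by (intro d) simp_all
          finally show "measure N (cis ` {p..q}) / \<eta> \<le> \<epsilon>"
            using \<eta> by (simp add: divide_le_eq mult.commute)
        qed
        then show ?thesis
          using \<eta> by (simp add: divide_le_eq mult.commute)
      qed
      then show ?case
        using d(1) by blast
    qed
    have "measure N (cis ` {s..t}) \<le> 0 + e" if "e > 0" for e
    proof -
      have "measure N (cis ` {s..t}) \<le> e / (t - s + 1) * (t - s)"
        using st that by (intro bound) simp
      also have "\<dots> \<le> e"
        using st that by (simp add: divide_le_eq mult_left_mono)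
      finally show ?thesis
        by simp
    qed
    then have "measure N (cis ` {s..t}) \<le> 0"
      by (rule field_le_epsilon)
    then show ?thesis
      by (simp add: measure_le_0_iff)
  qed
  define I where "I n = cis ` {a + inverse (real (Suc n))..b - inverse (real (Suc n))}" for n
  have "I n \<in> null_sets N" for n
  proof -
    have "measure N (I n) = 0"
    proof (cases "a + inverse (real (Suc n)) \<le> b - inverse (real (Suc n))")
      case True
      then show ?thesis
        unfolding I_def by (intro compact_null) simp_all
    next
      case False
      then show ?thesis
        by (simp add: I_def)
    qed
    then show ?thesis
      unfolding null_sets_def by (simp add: emeasure_eq_measure sets I_def cis_image_borel)
  qed
  then have "(\<Union>n. I n) \<in> null_sets N"
    by (rule null_sets_UN)
  moreover have "cis ` {a<..<b} \<subseteq> (\<Union>n. I n)"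
  proof
    fix \<zeta> assume "\<zeta> \<in> cis ` {a<..<b}"
    then obtain x where x: "\<zeta> = cis x" "a < x" "x < b"
      by auto
    then obtain n where "inverse (real (Suc n)) < min (x - a) (b - x)"
      using reals_Archimedean[of "min (x - a) (b - x)"] by auto
    then have "x \<in> {a + inverse (real (Suc n))..b - inverse (real (Suc n))}"
      by simp
    then show "\<zeta> \<in> (\<Union>n. I n)"
      unfolding I_def x(1) by blast
  qed
  ultimately have "measure N (cis ` {a<..<b}) \<le> measure N (\<Union>n. I n)"
    by (intro finite_measure_mono) (auto dest: null_setsD2)
  also have "\<dots> = 0"
    using \<open>(\<Union>n. I n) \<in> null_sets N\<close> by (simp add: measure_def null_setsD1)
  finally show ?thesis
    by (simp add: measure_le_0_iff)
qed

section \<open>The jump of the resolvent across the circle\<close>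

text \<open>The uniform limit of the difference quotients is over the unit ball, so \<open>h\<close> is first scaled into it.\<close>

lemma operator_analytic_on_tendsto:
  assumes T: "operator_analytic_on H T S" and z: "z \<in> S"
    and H: "complex_vector.subspace H" and h: "h \<in> H"
  shows "((\<lambda>w. T w h) \<longlongrightarrow> T z h) (at z)"
proof -
  define r where "r = 1 + norm h"
  define g where "g = complex_of_real (inverse r) *\<^sub>C h"
  have r: "r > 0"
    by (simp add: r_def add_pos_nonneg)
  have "norm g = inverse r * norm h"
    using r by (simp only: g_def norm_scaleC norm_of_real abs_of_pos positive_imp_inverse_positive)
  also have "\<dots> \<le> 1"
    using r by (simp add: r_def field_simps)
  finally have "norm g \<le> 1" .
  have "g \<in> H"
    unfolding g_def by (rule complex_vector.subspace_scale[OF H h])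
  have h_eq: "h = complex_of_real r *\<^sub>C g"
    using r by (simp add: g_def scaleC_scaleC scaleC_one flip: of_real_mult)
  have T_h: "T w h = complex_of_real r *\<^sub>C T w g" if "w \<in> S" for w
    using T that \<open>g \<in> H\<close> unfolding operator_analytic_on_def bounded_operator_on_def clinear_on_def
    by (subst h_eq) blast
  obtain T' where "uniform_limit {h \<in> H. norm h \<le> 1}
      (\<lambda>w h. inverse (w - z) *\<^sub>C (T w h - T z h)) T' (at z)"
    using T z unfolding operator_analytic_on_def by blast
  then have "((\<lambda>w. inverse (w - z) *\<^sub>C (T w g - T z g)) \<longlongrightarrow> T' g) (at z)"
    by (rule tendsto_uniform_limitI) (simp add: \<open>g \<in> H\<close> \<open>norm g \<le> 1\<close>)
  then have "((\<lambda>w. r * (cmod (w - z) * norm (inverse (w - z) *\<^sub>C (T w g - T z g))))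
      \<longlongrightarrow> r * (cmod (z - z) * norm (T' g))) (at z)"
    by (intro tendsto_intros)
  then have lim: "((\<lambda>w. r * (cmod (w - z) * norm (inverse (w - z) *\<^sub>C (T w g - T z g))))
      \<longlongrightarrow> 0) (at z)"
    by simp
  have "open S"
    using T by (simp add: operator_analytic_on_def)
  have "\<forall>\<^sub>F w in at z. r * (cmod (w - z) * norm (inverse (w - z) *\<^sub>C (T w g - T z g)))
      = norm (T w h - T z h)"
    using eventually_at_in_open[OF \<open>open S\<close> z]
  proof eventually_elim
    case (elim w)
    have "T w h - T z h = complex_of_real r *\<^sub>C (T w g - T z g)"
      using elim z by (simp add: T_h complex_vector.scale_right_diff_distrib)
    then show ?case
      using elim r by (simp add: norm_scaleC norm_inverse)
  qed
  with lim have "((\<lambda>w. norm (T w h - T z h)) \<longlongrightarrow> 0) (at z)"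
    by (rule Lim_transform_eventually)
  then show ?thesis
    by (simp add: tendsto_norm_zero_iff LIM_zero_iff)
qed

context spectral_unitary
begin

text \<open>The operator form of \<open>1 / (1 - z \<zeta>) - 1 / (1 - \<zeta> / cnj z) = (1 - \<bar>z\<bar>\<^sup>2) / \<bar>1 - z \<zeta>\<bar>\<^sup>2\<close> for
  \<open>\<bar>\<zeta>\<bar> = 1\<close>, the Poisson kernel.\<close>

lemma resolvent_jump:
  assumes z: "z \<noteq> 0"
    and X: "X - z *\<^sub>C U X = h" and Y: "Y - inverse (cnj z) *\<^sub>C U Y = h"
  shows "Re (cinner X h) - Re (cinner Y h) = (1 - (cmod z)\<^sup>2) * (norm X)\<^sup>2"
proof -
  define W where "W = Y - X"
  have zz: "cnj z * z = of_real ((cmod z)\<^sup>2)"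
    by (metis complex_norm_square mult.commute)
  \<comment> \<open>The two equations combine to \<open>U W - cnj z W = (\<bar>z\<bar>\<^sup>2 - 1) U X\<close>; pairing \<open>W\<close> with \<open>h = X - z U X\<close>
    produces the left-hand side paired with \<open>U X\<close>.\<close>
  have UY: "U Y = cnj z *\<^sub>C (Y - h)"
  proof -
    have "Y - h = inverse (cnj z) *\<^sub>C U Y"
      by (subst Y[symmetric]) simp
    then show ?thesis
      using z by (simp add: scaleC_scaleC scaleC_one)
  qed
  have "U W - cnj z *\<^sub>C W = cnj z *\<^sub>C (X - h) - U X"
    by (simp add: W_def U_diff UY complex_vector.scale_right_diff_distrib)
  also have "X - h = z *\<^sub>C U X"
    by (subst X[symmetric]) simp
  also have "cnj z *\<^sub>C (z *\<^sub>C U X) - U X = of_real ((cmod z)\<^sup>2 - 1) *\<^sub>C U X"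
    by (simp only: scaleC_scaleC zz of_real_diff complex_vector.scale_left_diff_distrib of_real_1 scaleC_one)
  finally have W: "U W - cnj z *\<^sub>C W = of_real ((cmod z)\<^sup>2 - 1) *\<^sub>C U X" .
  have "cinner W h = cinner W X - cnj z * cinner W (U X)"
    by (subst X[symmetric]) (simp add: cinner_diff_right cinner_scaleC_right)
  also have "cinner W X = cinner (U W) (U X)"
    by (simp add: cinner_U)
  also have "cinner (U W) (U X) - cnj z * cinner W (U X) = cinner (U W - cnj z *\<^sub>C W) (U X)"
    by (simp add: cinner_diff_left cinner_scaleC_left)
  also have "\<dots> = of_real ((cmod z)\<^sup>2 - 1) * of_real ((norm X)\<^sup>2)"
    unfolding W by (simp only: cinner_scaleC_left cinner_self norm_U)
  finally have "Re (cinner W h) = ((cmod z)\<^sup>2 - 1) * (norm X)\<^sup>2"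
    by (simp only: of_real_mult[symmetric] Re_complex_of_real)
  then show ?thesis
    by (simp add: W_def cinner_diff_left algebra_simps)
qed

text \<open>On the range of \<open>F I\<close> with \<open>I\<close> the part of the circle within \<open>\<epsilon>\<close> of \<open>\<omega>\<close>, the operator \<open>1 - z U\<close> with
  \<open>z = (1 - \<epsilon>) / \<omega>\<close> is bounded by \<open>2 \<epsilon>\<close>; so the resolvent of \<open>h\<close> is at least \<open>1 / (2 \<epsilon>)\<close> times as long
  as \<open>F I h\<close>, while its length is controlled by the jump of the resolvent across the circle.\<close>

lemma F_cball_le_resolvent_jump:
  assumes \<omega>: "cmod \<omega> = 1" and \<epsilon>: "0 < \<epsilon>" "\<epsilon> < 1"
    and X: "X - (of_real (1 - \<epsilon>) * cnj \<omega>) *\<^sub>C U X = h"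
    and Y: "Y - (of_real (inverse (1 - \<epsilon>)) * cnj \<omega>) *\<^sub>C U Y = h"
  shows "(norm (F (unit_circle \<inter> cball \<omega> \<epsilon>) h))\<^sup>2
    \<le> 4 * \<epsilon> * (Re (cinner X h) - Re (cinner Y h))"
proof -
  define I where "I = unit_circle \<inter> cball \<omega> \<epsilon>"
  define z where "z = of_real (1 - \<epsilon>) * cnj \<omega>"
  have I: "I \<in> circle_borel"
    unfolding I_def by (rule circle_cball_borel)
  have \<omega>\<omega>: "\<omega> * cnj \<omega> = 1"
    using complex_norm_square[of \<omega>] \<omega> by simp
  then have inv_\<omega>: "inverse \<omega> = cnj \<omega>"
    by (rule inverse_unique)
  have z: "cmod z = 1 - \<epsilon>" "inverse (cnj z) = of_real (inverse (1 - \<epsilon>)) * cnj \<omega>"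
    using \<omega> \<epsilon> by (simp_all add: z_def norm_mult inv_\<omega> del: of_real_diff)
  have near: "cmod (1 - z * \<zeta>) \<le> 2 * \<epsilon>" if "\<zeta> \<in> I" for \<zeta>
  proof -
    have "1 - z * \<zeta> = cnj \<omega> * (\<omega> - \<zeta>) + of_real \<epsilon> * (cnj \<omega> * \<zeta>)"
      by (simp add: z_def \<omega>\<omega> algebra_simps)
    then have "cmod (1 - z * \<zeta>) \<le> cmod (cnj \<omega> * (\<omega> - \<zeta>)) + cmod (of_real \<epsilon> * (cnj \<omega> * \<zeta>))"
      by (simp only: norm_triangle_ineq)
    also have "\<dots> \<le> \<epsilon> + \<epsilon>"
      using that \<omega> \<epsilon> by (intro add_mono) (simp_all add: I_def norm_mult dist_norm)
    finally show ?thesis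
      by simp
  qed
  have "F I h = F I X - z *\<^sub>C U (F I X)"
    unfolding X[symmetric] z_def[symmetric]
    by (simp add: F_diff[OF I] F_scaleC[OF I] F_commutes_U[OF I])
  then have "norm (F I h) \<le> 2 * \<epsilon> * norm (F I X)"
    using resolvent_upper_bound[OF I F_idem[OF I] _ near, of X] \<epsilon> by simp
  also have "\<dots> \<le> 2 * \<epsilon> * norm X"
    using \<epsilon> by (intro mult_left_mono norm_F_le I) simp
  finally have "(norm (F I h))\<^sup>2 \<le> (2 * \<epsilon> * norm X)\<^sup>2"
    by (intro power_mono) simp_all
  also have "\<dots> = 4 * \<epsilon> * (\<epsilon> * (norm X)\<^sup>2)"
    by (simp add: power2_eq_square)
  also have "\<dots> \<le> 4 * \<epsilon> * ((1 - (cmod z)\<^sup>2) * (norm X)\<^sup>2)"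
  proof -
    have "\<epsilon> * \<epsilon> \<le> \<epsilon> * 1"
      using \<epsilon> by (intro mult_left_mono) simp_all
    then have "\<epsilon> \<le> 1 - (cmod z)\<^sup>2"
      by (simp add: z power2_eq_square algebra_simps)
    then show ?thesis
      using \<epsilon> by (intro mult_left_mono mult_right_mono) simp_all
  qed
  also have "(1 - (cmod z)\<^sup>2) * (norm X)\<^sup>2 = Re (cinner X h) - Re (cinner Y h)"
  proof (rule resolvent_jump[symmetric])
    show "z \<noteq> 0"
      using z(1) \<epsilon> by auto
  qed (use X Y in \<open>simp_all only: z_def[symmetric] z(2)\<close>)
  finally show ?thesis
    by (simp add: I_def)
qed

end

section \<open>Vanishing of the spectral measure and analytic continuation\<close>

lemma open_off_circle_un_arc:
  assumes "open_arc \<Delta>"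
  shows "open ({z. cmod z < 1} \<union> {z. cmod z > 1} \<union> {z. cnj z \<in> \<Delta>})"
proof -
  have "\<Delta> \<subseteq> unit_circle"
    using open_arc_borel[OF assms] by (simp add: circle_borel_iff)
  then have "{z. cmod z < 1} \<union> {z. cmod z > 1} \<union> {z. cnj z \<in> \<Delta>} = - (cnj -` (unit_circle - \<Delta>))"
    by auto
  moreover have "closed (cnj -` (unit_circle - \<Delta>))"
    by (intro closed_vimage closed_diff_open_arc assms continuous_intros)
  ultimately show ?thesis
    by (simp add: open_Compl)
qed

context spectral_unitary
begin

lemma closed_csubspace_range_F:
  assumes "A \<in> circle_borel"
  shows "closed_csubspace {x. F A x = x}"
proof -
  obtain M where M: "closed_csubspace M" "F A = orth_proj M"
    by (rule F_orth_proj[OF assms])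
  then have "{x. F A x = x} = M"
    by (simp add: orth_proj_ident_iff)
  then show ?thesis
    using M(1) by simp
qed

lemma F_eq_0_iff_compression:
  assumes H: "closed_csubspace H" and A: "A \<in> circle_borel" and h: "h \<in> H"
  shows "compressed_spectral_measure H F A h = 0 \<longleftrightarrow> F A h = 0"
proof
  assume "compressed_spectral_measure H F A h = 0"
  then have "orth_proj H (F A h) = 0"
    by (simp add: compressed_spectral_measure_def)
  then have "cinner (F A h) h = 0"
    using cinner_orth_proj[OF H h, of "F A h"] by simp
  then show "F A h = 0"
    using Re_cinner_F[OF A, of h] by simp
next
  assume "F A h = 0"
  moreover have "orth_proj H 0 = 0"
    using H complex_vector.subspace_0 unfolding orth_proj_ident_iff[OF H] closed_csubspace_def by blast
  ultimately show "compressed_spectral_measure H F A h = 0"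
    by (simp add: compressed_spectral_measure_def)
qed

lemma generalized_resolvent_eq:
  assumes "cmod z \<noteq> 1" and "x - z *\<^sub>C U x = h"
  shows "generalized_resolvent H U z h = orth_proj H x"
proof -
  have "inv (\<lambda>x. x - z *\<^sub>C U x) h = x"
    using inv_resolvent[OF assms(1)] assms(2) by blast
  then show ?thesis
    by (simp only: generalized_resolvent_def)
qed

text \<open>The range \<open>M\<close> of \<open>F\<close> of the complementary arc reduces \<open>U\<close> and contains \<open>H\<close>, and the spectrum of \<open>U\<close> on
  \<open>M\<close> is disjoint from \<open>\<Delta>\<close>; so the inverse of \<open>1 - z U\<close> on \<open>M\<close> extends the resolvent across the conjugate arc.\<close>

lemma analytic_continuation_if_F_eq_0:
  assumes H: "closed_csubspace H" and \<Delta>: "open_arc \<Delta>" and null: "\<And>h. h \<in> H \<Longrightarrow> F \<Delta> h = 0"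
  shows "has_analytic_continuation H (generalized_resolvent H U)
    ({z. norm z < 1} \<union> {z. norm z > 1})
    ({z. norm z < 1} \<union> {z. norm z > 1} \<union> {z. cnj z \<in> \<Delta>})"
proof -
  define S where "S = {z. norm z < 1} \<union> {z. norm z > 1} \<union> {z. cnj z \<in> \<Delta>}"
  define B where "B = unit_circle - \<Delta>"
  define M where "M = {x. F B x = x}"
  have \<Delta>_borel: "\<Delta> \<in> circle_borel"
    by (rule open_arc_borel[OF \<Delta>])
  then have B: "B \<in> circle_borel"
    by (auto simp: B_def circle_borel_iff)
  have M: "closed_csubspace M"
    unfolding M_def by (rule closed_csubspace_range_F[OF B])
  have inv: "U y \<in> M \<longleftrightarrow> y \<in> M" for y
    by (simp add: M_def F_commutes_U[OF B] U_eq_iff)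
  have HM: "H \<subseteq> M"
    using null by (auto simp: M_def B_def F_fixed_Compl[OF \<Delta>_borel])
  have on_circle: "\<exists>c>0. \<forall>x\<in>M. c * norm x \<le> norm (x - z *\<^sub>C U x)"
    if z: "cmod z = 1" "cnj z \<in> \<Delta>" for z
  proof -
    obtain c where c: "c > 0" "\<And>\<zeta>. \<zeta> \<in> B \<Longrightarrow> c \<le> dist (cnj z) \<zeta>"
      using separate_point_closed[OF closed_diff_open_arc[OF \<Delta>], of "cnj z"] z
      by (auto simp: B_def)
    have "c \<le> cmod (1 - z * \<zeta>)" if "\<zeta> \<in> B" for \<zeta>
    proof -
      have "z * cnj z = 1"
        using complex_norm_square[of z] z by simp
      then have "1 - z * \<zeta> = z * (cnj z - \<zeta>)"
        by (simp add: right_diff_distrib)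
      then show ?thesis
        using c(2)[OF that] z by (simp add: norm_mult dist_norm)
    qed
    then have "c * norm x \<le> norm (x - z *\<^sub>C U x)" if "x \<in> M" for x
      using that c(1) resolvent_lower_bound[OF B] by (simp add: M_def)
    then show ?thesis
      using c(1) by blast
  qed
  have off_circle: "\<exists>c>0. \<forall>x\<in>M. c * norm x \<le> norm (x - z *\<^sub>C U x)" if "cmod z \<noteq> 1" for z
    using that resolvent_lower_bound_off_circle[of z]
    by (intro exI[of _ "\<bar>1 - cmod z\<bar>"]) simp
  have lower: "\<exists>c>0. \<forall>x\<in>M. c * norm x \<le> norm (x - z *\<^sub>C U x)" if "z \<in> S" for z
    using that on_circle off_circle by (cases "cmod z = 1") (auto simp: S_def)
  have exists: "\<exists>x\<in>M. x - z *\<^sub>C U x = h" if z: "z \<in> S" and h: "h \<in> M" for z h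
  proof (cases "cmod z = 1")
    case False
    then show ?thesis
      by (intro resolvent_exists_off_circle[OF M inv] h)
  next
    case True
    \<comment> \<open>The point \<open>z\<close> is reached from \<open>w = (1 - t) z\<close>, which lies in the disc and where \<open>c - t > t\<close> is a
      lower bound.\<close>
    obtain c where c: "c > 0" "\<And>x. x \<in> M \<Longrightarrow> c * norm x \<le> norm (x - z *\<^sub>C U x)"
      using lower[OF z] by blast
    define t where "t = min (c / 3) (1 / 2)"
    have t: "0 < t" "t < 1" "t < c - t"
      using c(1) by (auto simp: t_def min_def)
    define w where "w = of_real (1 - t) * z"
    have zw: "z - w = of_real t * z"
      by (simp add: w_def algebra_simps)
    show ?thesis
    proof (rule resolvent_exists_nearby[OF M, where z = w and c = "c - t"])
      show "cmod (z - w) < c - t"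
        using t True by (simp add: zw norm_mult)
      have "cmod w = 1 - t"
        using t True by (simp add: w_def norm_mult del: of_real_diff)
      then show "\<exists>x\<in>M. x - w *\<^sub>C U x = g" if "g \<in> M" for g
        using t by (intro resolvent_exists_off_circle[OF M inv] that) simp
      show "(c - t) * norm x \<le> norm (x - w *\<^sub>C U x)" if "x \<in> M" for x
      proof -
        have "x - z *\<^sub>C U x = (x - w *\<^sub>C U x) - (z - w) *\<^sub>C U x"
          by (simp add: complex_vector.scale_left_diff_distrib)
        then have "norm (x - z *\<^sub>C U x) \<le> norm (x - w *\<^sub>C U x) + norm ((z - w) *\<^sub>C U x)"
          by (simp only: norm_triangle_ineq4)
        also have "norm ((z - w) *\<^sub>C U x) = t * norm x"
          using t True by (simp add: zw norm_scaleC norm_mult)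
        finally show ?thesis
          using c(2)[OF that] by (simp add: left_diff_distrib)
      qed
    qed (simp_all add: inv h)
  qed
  define R where "R z h = (SOME x. x \<in> M \<and> x - z *\<^sub>C U x = h)" for z h
  have R: "R z h \<in> M" "R z h - z *\<^sub>C U (R z h) = h" if "z \<in> S" "h \<in> M" for z h
    using someI_ex[of "\<lambda>x. x \<in> M \<and> x - z *\<^sub>C U x = h"] exists[OF that] by (auto simp: R_def)
  have "operator_analytic_on H (\<lambda>z h. orth_proj H (R z h)) S"
  proof (rule resolvent_analytic[OF M _ H HM _ lower R])
    show "open S"
      unfolding S_def by (rule open_off_circle_un_arc[OF \<Delta>])
  qed (simp_all add: inv)
  moreover have "orth_proj H (R z h) = generalized_resolvent H U z h"
    if "z \<in> {z. norm z < 1} \<union> {z. norm z > 1}" "h \<in> H" for z h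
  proof (rule generalized_resolvent_eq[symmetric])
    show "cmod z \<noteq> 1"
      using that by auto
    show "R z h - z *\<^sub>C U (R z h) = h"
      using that HM by (intro R) (auto simp: S_def)
  qed
  ultimately show ?thesis
    unfolding has_analytic_continuation_def S_def by blast
qed

text \<open>For \<open>\<omega> \<in> \<Delta>\<close> the points \<open>(1 - \<epsilon>) / \<omega>\<close> and \<open>1 / ((1 - \<epsilon>) \<omega>)\<close> tend to \<open>1 / \<omega>\<close> from both sides of the
  circle, so the continuity of the continuation makes the jump, and with it the density of
  \<open>(F(\<cdot>) h, h)\<close>, vanish at \<open>\<omega>\<close>.\<close>

lemma F_eq_0_if_analytic_continuation:
  assumes H: "closed_csubspace H" and \<Delta>: "open_arc \<Delta>" and h: "h \<in> H"
    and continuation: "has_analytic_continuation H (generalized_resolvent H U)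
      ({z. norm z < 1} \<union> {z. norm z > 1})
      ({z. norm z < 1} \<union> {z. norm z > 1} \<union> {z. cnj z \<in> \<Delta>})"
  shows "F \<Delta> h = 0"
proof -
  obtain a b where \<Delta>_eq: "\<Delta> = cis ` {a<..<b}"
    using \<Delta> by (auto simp: open_arc_def)
  define S where "S = {z. norm z < 1} \<union> {z. norm z > 1} \<union> {z. cnj z \<in> \<Delta>}"
  obtain T where T: "operator_analytic_on H T S"
      "\<And>z. cmod z \<noteq> 1 \<Longrightarrow> T z h = generalized_resolvent H U z h"
    using continuation h unfolding has_analytic_continuation_def S_def
    by (auto simp: neq_iff)
  define q where "q z = Re (cinner (T z h) h)" for z
  have q_eq: "q z = Re (cinner x h)" if "cmod z \<noteq> 1" "x - z *\<^sub>C U x = h" for z x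
    using that by (simp add: q_def T(2) generalized_resolvent_eq cinner_orth_proj[OF H h])
  have exists: "\<exists>x. x - z *\<^sub>C U x = h" if "cmod z \<noteq> 1" for z
    using inv_resolvent[OF that] by blast
  have density: "\<forall>\<^sub>F \<epsilon> in at_right 0.
      measure (diag_measure F h) (unit_circle \<inter> cball (cis x) \<epsilon>) \<le> \<eta> * \<epsilon>"
    if x: "a < x" "x < b" and \<eta>: "\<eta> > 0" for x \<eta>
  proof -
    define \<omega> where "\<omega> = cis x"
    have "cnj \<omega> \<in> S"
      using x by (simp add: S_def \<omega>_def \<Delta>_eq)
    moreover have "complex_vector.subspace H"
      using H by (simp add: closed_csubspace_def)
    ultimately have "((\<lambda>w. T w h) \<longlongrightarrow> T (cnj \<omega>) h) (at (cnj \<omega>))"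
      by (intro operator_analytic_on_tendsto[OF T(1)] h)
    then have "isCont q (cnj \<omega>)"
      unfolding isCont_def q_def by (rule tendsto_Re_cinner)
    moreover have "((\<lambda>\<epsilon>. of_real (1 - \<epsilon>) * cnj \<omega>) \<longlongrightarrow> of_real (1 - 0) * cnj \<omega>) (at_right 0)"
      "((\<lambda>\<epsilon>. of_real (inverse (1 - \<epsilon>)) * cnj \<omega>) \<longlongrightarrow> of_real (inverse (1 - 0)) * cnj \<omega>)
        (at_right (0 :: real))"
      by (intro tendsto_intros; simp)+
    ultimately have "((\<lambda>\<epsilon>. q (of_real (1 - \<epsilon>) * cnj \<omega>)) \<longlongrightarrow> q (cnj \<omega>)) (at_right 0)"
      "((\<lambda>\<epsilon>. q (of_real (inverse (1 - \<epsilon>)) * cnj \<omega>)) \<longlongrightarrow> q (cnj \<omega>)) (at_right 0)"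
      by (auto intro: isCont_tendsto_compose)
    then have "((\<lambda>\<epsilon>. 4 * (q (of_real (1 - \<epsilon>) * cnj \<omega>) - q (of_real (inverse (1 - \<epsilon>)) * cnj \<omega>)))
        \<longlongrightarrow> 4 * (q (cnj \<omega>) - q (cnj \<omega>))) (at_right 0)"
      by (intro tendsto_intros)
    then have "\<forall>\<^sub>F \<epsilon> in at_right 0.
        4 * (q (of_real (1 - \<epsilon>) * cnj \<omega>) - q (of_real (inverse (1 - \<epsilon>)) * cnj \<omega>)) < \<eta>"
      by (rule order_tendstoD) (simp add: \<eta>)
    moreover have "\<forall>\<^sub>F \<epsilon> in at_right 0. \<epsilon> \<in> {0 <..< (1 :: real)}"
      by (rule eventually_at_right_real) simp
    ultimately show ?thesis
    proof eventually_elim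
      case (elim \<epsilon>)
      define z where "z = of_real (1 - \<epsilon>) * cnj \<omega>"
      define z' where "z' = of_real (inverse (1 - \<epsilon>)) * cnj \<omega>"
      have \<epsilon>: "0 < \<epsilon>" "\<epsilon> < 1"
        using elim by auto
      have "cmod z = 1 - \<epsilon>" "cmod z' = inverse (1 - \<epsilon>)"
        using \<epsilon> by (simp_all add: z_def z'_def \<omega>_def norm_mult del: of_real_diff of_real_inverse)
      then have z: "cmod z \<noteq> 1" "cmod z' \<noteq> 1"
        using \<epsilon> by (auto simp: inverse_eq_1_iff)
      obtain X Y where XY: "X - z *\<^sub>C U X = h" "Y - z' *\<^sub>C U Y = h"
        using exists z by blast
      have "measure (diag_measure F h) (unit_circle \<inter> cball \<omega> \<epsilon>)
          = (norm (F (unit_circle \<inter> cball \<omega> \<epsilon>) h))\<^sup>2"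
        by (rule measure_diag_measure[OF circle_cball_borel])
      also have "\<dots> \<le> 4 * \<epsilon> * (Re (cinner X h) - Re (cinner Y h))"
        using XY \<epsilon> by (intro F_cball_le_resolvent_jump) (simp_all only: z_def z'_def \<omega>_def norm_cis)
      also have "\<dots> = \<epsilon> * (4 * (q z - q z'))"
        using q_eq[OF z(1) XY(1)] q_eq[OF z(2) XY(2)] by simp
      also have "\<dots> \<le> \<epsilon> * \<eta>"
        using elim \<epsilon> by (intro mult_left_mono) (simp_all only: z_def z'_def less_imp_le)
      finally show ?case
        by (simp add: \<omega>_def mult.commute)
    qed
  qed
  have "measure (diag_measure F h) \<Delta> = 0"
    unfolding \<Delta>_eq
    by (intro null_arc_if_zero_density finite_diag_measure sets_diag_measure density)
  then show ?thesis
    by (simp add: measure_diag_measure open_arc_borel[OF \<Delta>])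
qed

end

theorem proposition3p1:
  fixes H D :: "'a :: chilbert_space set"
    and V U :: "'a \<Rightarrow> 'a"
    and F :: "complex set \<Rightarrow> 'a \<Rightarrow> 'a"
    and \<Delta> :: "complex set"
  assumes separable: "\<exists>S :: 'a set. countable S \<and> closure S = UNIV"
    and H: "closed_csubspace H"
    and V: "closed_isometric_operator H D V"
    and U: "unitary_operator U" "\<forall>x\<in>D. U x = V x"
    and F: "spectral_measure_of_unitary U F"
    and \<Delta>: "open_arc \<Delta>"
  shows "(\<forall>h\<in>H. compressed_spectral_measure H F \<Delta> h = 0) \<longleftrightarrow>
         has_analytic_continuation H (generalized_resolvent H U)
           ({z. norm z < 1} \<union> {z. norm z > 1})
           ({z. norm z < 1} \<union> {z. norm z > 1} \<union> {z. cnj z \<in> \<Delta>})"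
proof -
  interpret spectral_unitary U F
    by unfold_locales (fact U(1), fact F)
  have "(\<forall>h\<in>H. compressed_spectral_measure H F \<Delta> h = 0) \<longleftrightarrow> (\<forall>h\<in>H. F \<Delta> h = 0)"
    using F_eq_0_iff_compression[OF H open_arc_borel[OF \<Delta>]] by blast
  then show ?thesis
    using analytic_continuation_if_F_eq_0[OF H \<Delta>] F_eq_0_if_analytic_continuation[OF H \<Delta>]
    by blast
qed

end
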